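(* Let $\mathbf{Z}$ have rotationally symmetric distribution $\mathrm{P}_{\boldsymbol{\theta}_{\mathrm{M}},f}\in\mathfrak{P}_d$ on $\mathcal{S}^{d-1}$, with $\boldsymbol{\theta}_{\mathrm{M}}\in\mathcal{S}^{d-1}$ and angular function $f$, and let $\mathbf{F}$ be its directional distribution function. Then, letting $F_f^*(u):=Q_*(F_f(u))$ for $-1\le u\le 1$, $$\mathbf{F}(\mathbf{z})=F_f^*(\mathbf{z}^\top\boldsymbol{\theta}_{\mathrm{M}})\,\boldsymbol{\theta}_{\mathrm{M}}+\sqrt{1-\big(F_f^*(\mathbf{z}^\top\boldsymbol{\theta}_{\mathrm{M}})\big)^2}\;\mathbf{S}_{\boldsymbol{\theta}_{\mathrm{M}}}(\mathbf{z}).$$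
   Context: Let $d\ge 2$ and $\mathcal{S}^{d-1}=\{\mathbf{x}\in\mathbb{R}^d:\|\mathbf{x}\|=1\}$, with surface area measure $\lambda^{d-1}$. Let $c(\mathbf{y},\mathbf{z})=\tfrac12 d(\mathbf{y},\mathbf{z})^2$ with $d(\mathbf{y},\mathbf{z})=\arccos(\mathbf{y}^\top\mathbf{z})$. $\mathfrak{P}_d$ is the family of probability measures on $\mathcal{S}^{d-1}$ that are absolutely continuous with respect to $\lambda^{d-1}$ with densities bounded away from zero and infinity; $\mathrm{P}^{\mathbf{U}}$ is the uniform probability measure on $\mathcal{S}^{d-1}$. For $\mathrm{P}\in\mathfrak{P}_d$, the directional distribution function $\mathbf{F}$ of $\mathrm{P}$ is the $\mathrm{P}$-a.s. unique minimizer of $\int c(\mathbf{z},\mathbf{S}(\mathbf{z}))\,\mathrm{d}\mathrm{P}(\mathbf{z})$ among measurable $\mathbf{S}:\mathcal{S}^{d-1}\to\mathcal{S}^{d-1}$ pushing $\mathrm{P}$ forward to $\mathrm{P}^{\mathbf{U}}$ (taken in its continuous version, which is a homeomorphism). $\mathrm{P}_{\boldsymbol{\theta}_{\mathrm{M}},f}$ is the distribution with density $\mathbf{z}\mapsto c_f f(\mathbf{z}^\top\boldsymbol{\theta}_{\mathrm{M}})$ with respect to $\lambda^{d-1}$, where $f$ is a positive (angular) function on $[-1,1]$ and $c_f$ a norming constant; it is assumed that its rotation axis $\pm\boldsymbol{\theta}_{\mathrm{M}}$ is uniquely defined. Put $$F_f(u)=\frac{\int_{-1}^u f(s)(1-s^2)^{(d-3)/2}\,\mathrm{d}s}{\int_{-1}^1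 f(s)(1-s^2)^{(d-3)/2}\,\mathrm{d}s},\qquad F_*(u)=\frac{\int_{-1}^u(1-s^2)^{(d-3)/2}\,\mathrm{d}s}{\int_{-1}^1(1-s^2)^{(d-3)/2}\,\mathrm{d}s},\qquad -1\le u\le1,$$ (the distribution function of $\mathbf{Z}^\top\boldsymbol{\theta}_{\mathrm{M}}$ under $\mathrm{P}_{\boldsymbol{\theta}_{\mathrm{M}},f}$ and under $\mathrm{P}^{\mathbf{U}}$, respectively), and $Q_*=F_*^{-1}$. Finally $$\mathbf{S}_{\boldsymbol{\theta}_{\mathrm{M}}}(\mathbf{z})=\frac{\mathbf{z}-(\mathbf{z}^\top\boldsymbol{\theta}_{\mathrm{M}})\boldsymbol{\theta}_{\mathrm{M}}}{\|\mathbf{z}-(\mathbf{z}^\top\boldsymbol{\theta}_{\mathrm{M}})\boldsymbol{\theta}_{\mathrm{M}}\|},$$ with the convention $\boldsymbol{0}/0=\boldsymbol{0}$. *)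

theory Defs
  imports "HOL-Probability.Probability"
begin

abbreviation unit_sphere :: "(real^'n) set" where
  "unit_sphere \<equiv> sphere 0 1"

text \<open>
  The surface area measure is given by the polar-coordinates formula: the area of a Borel set
  \<open>A\<close> of the sphere is \<open>d\<close> times the Lebesgue measure of the cone
  \<open>{x. 0 < norm x < 1 \<and> x / norm x \<in> A}\<close>. In particular the total mass is \<open>d\<close> times the
  volume of the unit ball.
\<close>

definition surface_measure :: "(real^'n) measure" where
  "surface_measure =
     scale_measure (of_nat CARD('n))
       (distr (restrict_space lborel (ball 0 1 - {0})) (restrict_space borel unit_sphere)
          (\<lambda>x. x /\<^sub>R norm x))"

lemma space_surface_measure [simp]: "space surface_measure = unit_sphere"
  by (simp add: surface_measure_def space_scale_measure space_restrict_space)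

lemma sets_surface_measure [simp, measurable_cong]:
  "sets surface_measure = sets (restrict_space borel unit_sphere)"
  by (simp add: surface_measure_def)

lemma radial_projection_measurable:
  "(\<lambda>x::real^'n. x /\<^sub>R norm x)
     \<in> restrict_space lborel (ball 0 1 - {0}) \<rightarrow>\<^sub>M restrict_space borel unit_sphere"
proof (rule measurable_restrict_space2)
  have "(\<lambda>x::real^'n. x /\<^sub>R norm x) \<in> lborel \<rightarrow>\<^sub>M borel"
    by simp
  then show "(\<lambda>x::real^'n. x /\<^sub>R norm x) \<in> restrict_space lborel (ball 0 1 - {0}) \<rightarrow>\<^sub>M borel"
    by (rule measurable_restrict_space1)
qed (auto simp: space_restrict_space)

lemma emeasure_surface_measure:
  fixes A :: "(real^'n) set"
  assumes "A \<in> sets borel" "A \<subseteq> unit_sphere"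
  shows "emeasure surface_measure A =
           of_nat CARD('n) * emeasure lborel {x. 0 < norm x \<and> norm x < 1 \<and> x /\<^sub>R norm x \<in> A}"
proof -
  have A: "A \<in> sets (restrict_space borel unit_sphere)"
    using assms by (auto simp: sets_restrict_space)
  have "(\<lambda>x. x /\<^sub>R norm x) -` A \<inter> space (restrict_space lborel (ball 0 1 - {0})) =
          {x. 0 < norm x \<and> norm x < 1 \<and> x /\<^sub>R norm x \<in> A}"
    by (auto simp: space_restrict_space)
  with A show ?thesis
    by (simp add: surface_measure_def emeasure_scale_measure
        emeasure_distr[OF radial_projection_measurable] emeasure_restrict_space subset_iff)
qed

definition uniform_sphere :: "(real^'n) measure" where
  "uniform_sphere = uniform_measure surface_measure unit_sphere"

definition geodesic_dist :: "real^'n \<Rightarrow> real^'n \<Rightarrow> real" where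
  "geodesic_dist y z = arccos (y \<bullet> z)"

definition transport_cost :: "real^'n \<Rightarrow> real^'n \<Rightarrow> real" where
  "transport_cost y z = (geodesic_dist y z)\<^sup>2 / 2"

definition bounded_density_family :: "(real^'n) measure set" where
  "bounded_density_family =
     {P. prob_space P \<and>
         (\<exists>g \<in> borel_measurable surface_measure. \<exists>a b. 0 < a \<and>
            (\<forall>z\<in>unit_sphere. a \<le> g z \<and> g z \<le> b) \<and>
            P = density surface_measure (\<lambda>z. ennreal (g z)))}"

definition transport_maps :: "(real^'n) measure \<Rightarrow> (real^'n \<Rightarrow> real^'n) set" where
  "transport_maps P =
     {S \<in> P \<rightarrow>\<^sub>M restrict_space borel unit_sphere.
        distr P (restrict_space borel unit_sphere) S = uniform_sphere}"

definition optimal_transport_map :: "(real^'n) measure \<Rightarrow> (real^'n \<Rightarrow> real^'n) \<Rightarrow> bool" where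
  "optimal_transport_map P S \<longleftrightarrow>
     S \<in> transport_maps P \<and>
     (\<forall>T \<in> transport_maps P.
        (\<integral>z. transport_cost z (S z) \<partial>P) \<le> (\<integral>z. transport_cost z (T z) \<partial>P))"

text \<open>
  The continuous version of the almost surely unique optimal map. Maps of the sphere are
  represented by functions on the whole space; membership in \<open>extensional unit_sphere\<close> fixes the
  irrelevant values outside the sphere, so that the description can be unique.
\<close>

definition directional_df :: "(real^'n) measure \<Rightarrow> real^'n \<Rightarrow> real^'n" where
  "directional_df P =
     (THE F. F \<in> extensional unit_sphere \<and> continuous_on unit_sphere F \<and>
        optimal_transport_map P F \<and>
        (\<forall>S. optimal_transport_map P S \<longrightarrow> (AE z in P. S z = F z)))"

definition angular_function :: "(real \<Rightarrow> real) \<Rightarrow> bool" where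
  "angular_function f \<longleftrightarrow>
     f \<in> borel_measurable (restrict_space borel {-1..1}) \<and> (\<forall>u\<in>{-1..1}. 0 < f u)"

definition norming_const :: "real^'n \<Rightarrow> (real \<Rightarrow> real) \<Rightarrow> real" where
  "norming_const \<theta> f = 1 / (\<integral>z. f (z \<bullet> \<theta>) \<partial>surface_measure)"

definition rotsym_distribution :: "real^'n \<Rightarrow> (real \<Rightarrow> real) \<Rightarrow> (real^'n) measure" where
  "rotsym_distribution \<theta> f =
     density surface_measure (\<lambda>z. ennreal (norming_const \<theta> f * f (z \<bullet> \<theta>)))"

text \<open>Any representation of the distribution in rotationally symmetric form has the same axis.\<close>

definition unique_rotation_axis :: "real^'n \<Rightarrow> (real \<Rightarrow> real) \<Rightarrow> bool" where
  "unique_rotation_axis \<theta> f \<longleftrightarrow>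
     (\<forall>\<eta>\<in>unit_sphere. \<forall>g. angular_function g \<and>
        rotsym_distribution \<eta> g = rotsym_distribution \<theta> f \<longrightarrow> \<eta> = \<theta> \<or> \<eta> = - \<theta>)"

text \<open>
  The factor \<open>(1 - s\<^sup>2) powr ((d - 3) / 2)\<close> is singular at the end points if \<open>d = 2\<close>, and
  \<open>0 powr 0 = 0\<close> in HOL; the values at these two points do not affect the integrals.
\<close>

definition angular_cdf :: "nat \<Rightarrow> (real \<Rightarrow> real) \<Rightarrow> real \<Rightarrow> real" where
  "angular_cdf d f u =
     (LBINT s:{-1..u}. f s * (1 - s\<^sup>2) powr ((real d - 3) / 2)) /
     (LBINT s:{-1..1}. f s * (1 - s\<^sup>2) powr ((real d - 3) / 2))"

definition uniform_angular_cdf :: "nat \<Rightarrow> real \<Rightarrow> real" where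
  "uniform_angular_cdf d u =
     (LBINT s:{-1..u}. (1 - s\<^sup>2) powr ((real d - 3) / 2)) /
     (LBINT s:{-1..1}. (1 - s\<^sup>2) powr ((real d - 3) / 2))"

definition uniform_angular_quantile :: "nat \<Rightarrow> real \<Rightarrow> real" where
  "uniform_angular_quantile d = the_inv_into {-1..1} (uniform_angular_cdf d)"

definition angular_transport :: "nat \<Rightarrow> (real \<Rightarrow> real) \<Rightarrow> real \<Rightarrow> real" where
  "angular_transport d f u = uniform_angular_quantile d (angular_cdf d f u)"

text \<open>Since \<open>inverse 0 = 0\<close>, this is \<open>0\<close> at the poles \<open>\<plusminus>\<theta>\<close>.\<close>

definition directional_sign :: "real^'n \<Rightarrow> real^'n \<Rightarrow> real^'n" where
  "directional_sign \<theta> z = (z - (z \<bullet> \<theta>) *\<^sub>R \<theta>) /\<^sub>R norm (z - (z \<bullet> \<theta>) *\<^sub>R \<theta>)"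

end

theory Submission
  imports Defs
begin

text \<open>
  The map in question moves every point along its meridian, from latitude \<open>u = z \<bullet> \<theta>\<close> to latitude
  \<open>m u = Q\<^sub>*(F\<^sub>f u)\<close>. Its optimality is a one-dimensional matter. The colatitude
  \<open>z \<mapsto> arccos (z \<bullet> \<theta>)\<close> is \<open>1\<close>-Lipschitz for the geodesic distance, so the spherical cost of
  moving \<open>y\<close> to \<open>z\<close> is at least half the squared difference of their colatitudes; a motion along
  a meridian attains this bound (\<open>colatitude_diff_le_geodesic_dist\<close>,
  \<open>geodesic_dist_meridian_map\<close>). On the line, for the quadratic cost, the increasing map
  \<open>t \<mapsto> arccos (m (cos t))\<close> is optimal: Young's inequality for its primitive, which is strictly
  convex, yields a pair of potentials whose sum stays below the cost and touches it exactly on the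
  graph of that map (\<open>quadratic_cost_potentials\<close>). Composed with the colatitude these become
  potentials on the sphere. By duality (\<open>optimal_transport_map_certificate\<close>) the meridian map is
  optimal, and any other optimal map \<open>S\<close> makes both inequalities tight almost everywhere: \<open>S z\<close>
  has latitude \<open>m (z \<bullet> \<theta>)\<close> and lies on the meridian of \<open>z\<close>, so it is the image of \<open>z\<close> under the
  meridian map.

  That the meridian map carries the rotationally symmetric law to the uniform one comes from polar
  coordinates. The surface measure is the product of a measure on the equator and of the weight
  \<open>(1 - u\<^sup>2) powr ((d - 3) / 2)\<close> on latitudes (\<open>nn_integral_surface_measure_polar\<close>). A function of
  the latitude as density changes only the second factor, and there the composition of one
  distribution function with the inverse of another is the monotone transport (\<open>distr_m\<close>).
  The polar formula is derived from the definition of the surface measure by cones with no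
  coordinates and no choice of a rotation: translation invariance of Lebesgue measure and Tonelli's
  theorem already slice space into lines parallel to \<open>\<theta>\<close> (\<open>nn_integral_lborel_slices\<close>).

  Finally, the law charges every nonempty open part of the sphere, so the continuous version of the
  optimal map is unique and the definite description of the directional distribution function
  picks the meridian map.
\<close>


section \<open>Lebesgue measure sliced along an axis\<close>

abbreviation perp :: "'a::euclidean_space \<Rightarrow> 'a \<Rightarrow> 'a" where
  "perp \<theta> x \<equiv> x - (x \<bullet> \<theta>) *\<^sub>R \<theta>"

lemma nn_integral_lborel_translate:
  fixes h :: "'a::euclidean_space \<Rightarrow> ennreal"
  assumes [measurable]: "h \<in> borel_measurable borel"
  shows "(\<integral>\<^sup>+x. h (c + x) \<partial>lborel) = (\<integral>\<^sup>+x. h x \<partial>lborel)"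
proof -
  have "(\<integral>\<^sup>+x. h x \<partial>lborel) = (\<integral>\<^sup>+x. h x \<partial>distr lborel borel ((+) c))"
    by (simp add: lborel_distr_plus)
  also have "\<dots> = (\<integral>\<^sup>+x. h (c + x) \<partial>lborel)"
    by (subst nn_integral_distr) auto
  finally show ?thesis by simp
qed

text \<open>
  The points of the slab \<open>0 \<le> x \<bullet> \<theta> \<le> 1\<close> serve as parameters for the lines parallel to \<open>\<theta>\<close>; as
  every line meets the slab in unit length, each is counted with the right weight. The proof
  averages over all translates of the slab, which cover every point for a total length \<open>1\<close>, and then
  undoes the translation. The slab thus replaces the Lebesgue measure of the hyperplane orthogonal
  to \<open>\<theta>\<close>, and no such measure has to be constructed.
\<close>
lemma nn_integral_lborel_slices:
  fixes h :: "'a::euclidean_space \<Rightarrow> ennreal"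
  assumes [measurable]: "h \<in> borel_measurable borel" and \<theta>: "norm \<theta> = 1"
  shows "(\<integral>\<^sup>+x. h x \<partial>lborel) =
    (\<integral>\<^sup>+x. indicator {0..1} (x \<bullet> \<theta>) * (\<integral>\<^sup>+s. h (perp \<theta> x + s *\<^sub>R \<theta>) \<partial>lborel) \<partial>lborel)"
proof -
  have \<theta>\<theta>: "\<theta> \<bullet> \<theta> = 1" using \<theta> by (simp add: norm_eq_1)
  have "(\<integral>\<^sup>+x. h x \<partial>lborel) =
      (\<integral>\<^sup>+x. (\<integral>\<^sup>+s. h x * indicator {0..1} (x \<bullet> \<theta> - s) \<partial>lborel) \<partial>lborel)"
  proof (rule nn_integral_cong)
    fix x
    have "(\<integral>\<^sup>+s. indicator {0..1} (x \<bullet> \<theta> - s) \<partial>lborel)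
        = (\<integral>\<^sup>+s. indicator {x \<bullet> \<theta> - 1..x \<bullet> \<theta>} s \<partial>lborel)"
      by (intro nn_integral_cong) (auto split: split_indicator)
    then show "h x = (\<integral>\<^sup>+s. h x * indicator {0..1} (x \<bullet> \<theta> - s) \<partial>lborel)"
      by (simp add: nn_integral_cmult)
  qed
  also have "\<dots> = (\<integral>\<^sup>+s. (\<integral>\<^sup>+x. h x * indicator {0..1} (x \<bullet> \<theta> - s) \<partial>lborel) \<partial>lborel)"
    by (rule lborel_pair.Fubini') measurable
  also have "\<dots> = (\<integral>\<^sup>+s. (\<integral>\<^sup>+x. h (s *\<^sub>R \<theta> + x) * indicator {0..1} (x \<bullet> \<theta>) \<partial>lborel) \<partial>lborel)"
  proof (rule nn_integral_cong)
    fix s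
    show "(\<integral>\<^sup>+x. h x * indicator {0..1} (x \<bullet> \<theta> - s) \<partial>lborel) =
      (\<integral>\<^sup>+x. h (s *\<^sub>R \<theta> + x) * indicator {0..1} (x \<bullet> \<theta>) \<partial>lborel)"
      by (subst nn_integral_lborel_translate[where c = "s *\<^sub>R \<theta>", symmetric])
        (auto simp: inner_add_left \<theta>\<theta>)
  qed
  also have "\<dots> = (\<integral>\<^sup>+x. (\<integral>\<^sup>+s. h (s *\<^sub>R \<theta> + x) * indicator {0..1} (x \<bullet> \<theta>) \<partial>lborel) \<partial>lborel)"
    by (rule lborel_pair.Fubini') measurable
  also have "\<dots> = (\<integral>\<^sup>+x. indicator {0..1} (x \<bullet> \<theta>) * (\<integral>\<^sup>+s. h (perp \<theta> x + s *\<^sub>R \<theta>) \<partial>lborel) \<partial>lborel)"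
  proof (rule nn_integral_cong)
    fix x
    have "(\<integral>\<^sup>+s. h (s *\<^sub>R \<theta> + x) \<partial>lborel) = (\<integral>\<^sup>+s. h (perp \<theta> x + s *\<^sub>R \<theta>) \<partial>lborel)"
      by (subst nn_integral_lborel_translate[where c = "x \<bullet> \<theta>", symmetric])
        (auto simp: algebra_simps)
    then show "(\<integral>\<^sup>+s. h (s *\<^sub>R \<theta> + x) * indicator {0..1} (x \<bullet> \<theta>) \<partial>lborel) =
        indicator {0..1} (x \<bullet> \<theta>) * (\<integral>\<^sup>+s. h (perp \<theta> x + s *\<^sub>R \<theta>) \<partial>lborel)"
      by (subst nn_integral_multc) (auto simp: mult.commute)
  qed
  finally show ?thesis .
qed

text \<open>
  Functions of the orthogonal part see the slab only through its width. This makes the next lemma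
  possible: a dilation of the whole space changes the width of the slab, and after correcting for
  that one factor a dilation of the hyperplane remains, with exponent \<open>d - 1\<close>.
\<close>
lemma nn_integral_strip_width:
  fixes g :: "'a::euclidean_space \<Rightarrow> ennreal"
  assumes [measurable]: "g \<in> borel_measurable borel" and \<theta>: "norm \<theta> = 1" and "0 \<le> L"
  shows "(\<integral>\<^sup>+x. indicator {0..L} (x \<bullet> \<theta>) * g (perp \<theta> x) \<partial>lborel) =
    ennreal L * (\<integral>\<^sup>+x. indicator {0..1} (x \<bullet> \<theta>) * g (perp \<theta> x) \<partial>lborel)"
proof -
  have \<theta>\<theta>: "\<theta> \<bullet> \<theta> = 1" using \<theta> by (simp add: norm_eq_1)
  have *: "(\<integral>\<^sup>+s. indicator {0..L} ((perp \<theta> x + s *\<^sub>R \<theta>) \<bullet> \<theta>) * g (perp \<theta> (perp \<theta> x + s *\<^sub>R \<theta>)) \<partial>lborel)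
      = ennreal L * g (perp \<theta> x)" for x :: 'a
    using \<open>0 \<le> L\<close> by (simp add: inner_add_left inner_diff_left \<theta>\<theta> nn_integral_multc)
  show ?thesis
    by (subst nn_integral_lborel_slices[OF _ \<theta>], simp)
      (simp only: *, subst nn_integral_cmult[symmetric], auto intro!: nn_integral_cong simp: ac_simps)
qed

lemma nn_integral_strip_scale:
  fixes g :: "'a::euclidean_space \<Rightarrow> ennreal"
  assumes [measurable]: "g \<in> borel_measurable borel" and \<theta>: "norm \<theta> = 1" and a: "0 < a"
  shows "(\<integral>\<^sup>+x. indicator {0..1} (x \<bullet> \<theta>) * g (perp \<theta> x) \<partial>lborel) =
    ennreal (a ^ (DIM('a) - 1)) * (\<integral>\<^sup>+x. indicator {0..1} (x \<bullet> \<theta>) * g (a *\<^sub>R perp \<theta> x) \<partial>lborel)"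
proof -
  have d: "DIM('a) = Suc (DIM('a) - 1)" using DIM_positive[where 'a='a] by simp
  define I where "I = (\<integral>\<^sup>+x. indicator {0..1} (x \<bullet> \<theta>) * g (a *\<^sub>R perp \<theta> x) \<partial>lborel)"
  have "ennreal a * (\<integral>\<^sup>+x. indicator {0..1} (x \<bullet> \<theta>) * g (perp \<theta> x) \<partial>lborel)
     = (\<integral>\<^sup>+x. indicator {0..a} (x \<bullet> \<theta>) * g (perp \<theta> x) \<partial>lborel)"
    using a by (subst (2) nn_integral_strip_width[OF _ \<theta>]) auto
  also have "\<dots> = (\<integral>\<^sup>+x. indicator {0..a} (x \<bullet> \<theta>) * g (perp \<theta> x)
       \<partial>density (distr lborel borel (\<lambda>x::'a. 0 + a *\<^sub>R x)) (\<lambda>_. \<bar>a\<bar>^DIM('a)))"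
    using a by (subst lborel_affine[of a 0]) auto
  also have "\<dots> = ennreal (a ^ DIM('a)) *
      (\<integral>\<^sup>+x. indicator {0..a} (a * (x \<bullet> \<theta>)) * g (a *\<^sub>R perp \<theta> x) \<partial>lborel)"
    using a by (simp add: nn_integral_density nn_integral_distr nn_integral_cmult
        scaleR_diff_right)
  also have "(\<integral>\<^sup>+x. indicator {0..a} (a * (x \<bullet> \<theta>)) * g (a *\<^sub>R perp \<theta> x) \<partial>lborel) = I"
    unfolding I_def using a
    by (intro nn_integral_cong) (auto split: split_indicator simp: zero_le_mult_iff)
  also have "ennreal (a ^ DIM('a)) * I = ennreal a * (ennreal (a ^ (DIM('a) - 1)) * I)"
  proof -
    have "a ^ DIM('a) = a * a ^ (DIM('a) - 1)" by (metis d power_Suc)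
    then show ?thesis using a by (simp add: ennreal_mult mult.assoc)
  qed
  finally show ?thesis
    using a by (subst (asm) ennreal_mult_cancel_left) (auto simp: I_def)
qed

section \<open>The angular weight\<close>

definition axial_weight :: "nat \<Rightarrow> real \<Rightarrow> real" where
  "axial_weight d s = (1 - s\<^sup>2) powr ((real d - 3) / 2)"

lemma axial_weight_measurable [measurable]: "axial_weight d \<in> borel_measurable borel"
  unfolding axial_weight_def[abs_def] by measurable

text \<open>
  The slope \<open>v = t / r\<close> of a point at height \<open>t\<close> over the hyperplane and at distance \<open>r\<close> from the axis
  is the cotangent of its colatitude; \<open>cos_of_cot v\<close> is then its latitude after projection to
  the sphere.
\<close>
definition cos_of_cot :: "real \<Rightarrow> real" where "cos_of_cot v = v / sqrt (1 + v\<^sup>2)"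

lemma cos_of_cot_measurable [measurable]: "cos_of_cot \<in> borel_measurable borel"
  unfolding cos_of_cot_def[abs_def] by measurable

lemma one_plus_square_pos: "0 < 1 + (v::real)\<^sup>2"
  by (simp add: add_pos_nonneg)

lemma sin_of_cot: "1 - (cos_of_cot v)\<^sup>2 = (1 / sqrt (1 + v\<^sup>2))\<^sup>2"
  using one_plus_square_pos[of v] by (simp add: cos_of_cot_def power_divide field_simps)

lemma cos_of_cot_bounds: "cos_of_cot v \<in> {-1<..<1}"
proof -
  have "0 < (1 / sqrt (1 + v\<^sup>2))\<^sup>2"
    using one_plus_square_pos[of v] by simp
  then have "(cos_of_cot v)\<^sup>2 < 1" unfolding sin_of_cot[symmetric] by simp
  then show ?thesis by (simp add: abs_square_less_1 abs_less_iff)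
qed

lemma DERIV_cos_of_cot: "(cos_of_cot has_real_derivative (1 / sqrt (1 + v\<^sup>2)) ^ 3) (at v)"
proof -
  have p: "0 < 1 + v\<^sup>2" by (rule one_plus_square_pos)
  have s2: "(sqrt (1 + v\<^sup>2))\<^sup>2 = 1 + v\<^sup>2" using p by simp
  have "(cos_of_cot has_real_derivative
      (1 * sqrt (1 + v\<^sup>2) - v * (v / sqrt (1 + v\<^sup>2))) / (sqrt (1 + v\<^sup>2))\<^sup>2) (at v)"
    unfolding cos_of_cot_def[abs_def] using p
    by (auto intro!: derivative_eq_intros simp: divide_simps power2_eq_square)
  moreover have "(1 * sqrt (1 + v\<^sup>2) - v * (v / sqrt (1 + v\<^sup>2))) / (sqrt (1 + v\<^sup>2))\<^sup>2
      = (1 / sqrt (1 + v\<^sup>2)) ^ 3"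
    using p s2 by (simp add: field_simps power3_eq_cube power2_eq_square)
  ultimately show ?thesis by simp
qed

lemma strict_mono_cos_of_cot: "strict_mono cos_of_cot"
proof (rule strict_monoI)
  fix x y :: real assume "x < y"
  show "cos_of_cot x < cos_of_cot y"
    by (rule DERIV_pos_imp_increasing[OF \<open>x < y\<close>])
      (use DERIV_cos_of_cot one_plus_square_pos in \<open>force intro!: exI\<close>)
qed

lemma cos_of_cot_inverse:
  assumes "u \<in> {-1<..<1}" shows "cos_of_cot (u / sqrt (1 - u\<^sup>2)) = u"
proof -
  have "u\<^sup>2 < 1" using assms by (simp add: abs_square_less_1 abs_less_iff)
  then have "1 + (u / sqrt (1 - u\<^sup>2))\<^sup>2 = 1 / (1 - u\<^sup>2)"
    by (simp add: power_divide field_simps)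
  with \<open>u\<^sup>2 < 1\<close> show ?thesis by (simp add: cos_of_cot_def real_sqrt_divide)
qed

lemma UN_cos_of_cot_intervals: "(\<Union>n::nat. {cos_of_cot (- real n)..cos_of_cot (real n)}) = {-1<..<1}"
proof (intro set_eqI iffI)
  fix u :: real assume "u \<in> (\<Union>n::nat. {cos_of_cot (- real n)..cos_of_cot (real n)})"
  then obtain n :: nat where "cos_of_cot (- real n) \<le> u" "u \<le> cos_of_cot (real n)" by auto
  then show "u \<in> {-1<..<1}"
    using cos_of_cot_bounds[of "real n"] cos_of_cot_bounds[of "- real n"] by auto
next
  fix u :: real assume u: "u \<in> {-1<..<1}"
  obtain n :: nat where n: "\<bar>u / sqrt (1 - u\<^sup>2)\<bar> \<le> real n" using real_arch_simple by blast
  then have "- real n \<le> u / sqrt (1 - u\<^sup>2)" "u / sqrt (1 - u\<^sup>2) \<le> real n"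
    by linarith+
  then have "cos_of_cot (- real n) \<le> cos_of_cot (u / sqrt (1 - u\<^sup>2))"
     "cos_of_cot (u / sqrt (1 - u\<^sup>2)) \<le> cos_of_cot (real n)"
    using strict_mono_less_eq[OF strict_mono_cos_of_cot] by blast+
  then show "u \<in> (\<Union>n::nat. {cos_of_cot (- real n)..cos_of_cot (real n)})"
    using cos_of_cot_inverse[OF u] by auto
qed

lemma axial_weight_cos_of_cot:
  "axial_weight d (cos_of_cot v) * (1 / sqrt (1 + v\<^sup>2)) ^ 3 = (1 / sqrt (1 + v\<^sup>2)) ^ d"
proof -
  define a where "a = 1 / sqrt (1 + v\<^sup>2)"
  have a: "0 < a" using one_plus_square_pos[of v] by (simp add: a_def)
  have "axial_weight d (cos_of_cot v) = (a powr 2) powr ((real d - 3) / 2)"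
    using a by (simp add: axial_weight_def sin_of_cot a_def)
  also have "\<dots> = a powr (2 * ((real d - 3) / 2))" by (rule powr_powr)
  also have "2 * ((real d - 3) / 2) = real d - 3" by simp
  finally have "axial_weight d (cos_of_cot v) * a ^ 3 = a powr (real d - 3) * a powr 3"
    using a by simp
  also have "\<dots> = a powr real d" by (simp only: powr_add[symmetric]) simp
  also have "\<dots> = a ^ d" using a by (rule powr_realpow)
  finally show ?thesis by (simp add: a_def)
qed

text \<open>
  The substitution rule applies on compact intervals, so the two measures are first compared on
  the images of \<open>{-n..n}\<close>, which exhaust \<open>{-1<..<1}\<close>. With \<open>a = 1 / sqrt (1 + v\<^sup>2)\<close>, the weight at the
  image of \<open>v\<close> is \<open>a powr (d - 3)\<close> and the derivative is \<open>a ^ 3\<close>.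
\<close>
lemma distr_cos_of_cot:
  "distr (density lborel (\<lambda>v. ennreal ((1 / sqrt (1 + v\<^sup>2)) ^ d))) borel cos_of_cot =
   density lborel (\<lambda>u. ennreal (axial_weight d u) * indicator {-1<..<1} u)" (is "?M1 = ?M2")
proof (rule measure_eqI)
  fix A assume "A \<in> sets ?M1"
  then have A[measurable]: "A \<in> sets borel" by simp
  let ?B = "\<lambda>n::nat. {cos_of_cot (- real n)..cos_of_cot (real n)}"
  have e1: "emeasure ?M1 X = (\<integral>\<^sup>+v. ennreal ((1 / sqrt (1 + v\<^sup>2)) ^ d) * indicator X (cos_of_cot v) \<partial>lborel)"
    if [measurable]: "X \<in> sets borel" for X
    by (subst nn_integral_indicator[symmetric], simp)
      (simp add: nn_integral_distr nn_integral_density del: nn_integral_indicator)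
  have e2: "emeasure ?M2 X = (\<integral>\<^sup>+u. ennreal (axial_weight d u) * indicator {-1<..<1} u * indicator X u \<partial>lborel)"
    if [measurable]: "X \<in> sets borel" for X
    by (subst emeasure_density) auto
  have eq: "emeasure ?M1 (A \<inter> ?B n) = emeasure ?M2 (A \<inter> ?B n)" for n
  proof -
    let ?f = "\<lambda>u. axial_weight d u * indicator A u"
    have "emeasure ?M2 (A \<inter> ?B n) = (\<integral>\<^sup>+u. ennreal (?f u) * indicator (?B n) u \<partial>lborel)"
    proof (subst e2, simp, rule nn_integral_cong)
      fix u
      show "ennreal (axial_weight d u) * indicator {-1<..<1} u * indicator (A \<inter> ?B n) u
          = ennreal (?f u) * indicator (?B n) u"
        using UN_cos_of_cot_intervals by (auto split: split_indicator)
    qed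
    also have "\<dots> = (\<integral>\<^sup>+u. ennreal (?f u * indicator (?B n) u) \<partial>lborel)"
      by (intro nn_integral_cong) (auto split: split_indicator)
    also have "\<dots> = (\<integral>\<^sup>+v. ennreal (?f (cos_of_cot v) * (1 / sqrt (1 + v\<^sup>2)) ^ 3
         * indicator {- real n..real n} v) \<partial>lborel)"
      using DERIV_cos_of_cot one_plus_square_pos
      by (intro nn_integral_substitution)
        (auto simp: set_borel_measurable_def less_imp_le less_imp_neq[symmetric] intro!: continuous_intros)
    also have "\<dots> = emeasure ?M1 (A \<inter> ?B n)"
    proof (subst e1, simp, rule nn_integral_cong)
      fix v
      have "indicator (?B n) (cos_of_cot v) = (indicator {- real n..real n} v :: ennreal)"
        using strict_mono_cos_of_cot by (auto split: split_indicator simp: strict_mono_less_eq)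
      then show "ennreal (?f (cos_of_cot v) * (1 / sqrt (1 + v\<^sup>2)) ^ 3
         * indicator {- real n..real n} v) =
         ennreal ((1 / sqrt (1 + v\<^sup>2)) ^ d) * indicator (A \<inter> ?B n) (cos_of_cot v)"
        unfolding axial_weight_cos_of_cot[of d v, symmetric]
        by (auto split: split_indicator split_indicator_asm)
    qed
    finally show ?thesis by simp
  qed
  have inc: "incseq (\<lambda>n. A \<inter> ?B n)"
    using strict_mono_cos_of_cot
    by (intro incseq_SucI) (auto intro: order_trans simp: strict_mono_less_eq
        elim!: order_trans[rotated] order_trans)
  have un: "(\<Union>n. A \<inter> ?B n) = A \<inter> {-1<..<1}" using UN_cos_of_cot_intervals by blast
  have "emeasure ?M1 (A \<inter> {-1<..<1}) = emeasure ?M2 (A \<inter> {-1<..<1})"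
    using SUP_emeasure_incseq[OF _ inc, of ?M1] SUP_emeasure_incseq[OF _ inc, of ?M2] eq
    unfolding un by (simp add: image_subset_iff)
  moreover have "emeasure ?M1 (A \<inter> {-1<..<1}) = emeasure ?M1 A"
    using cos_of_cot_bounds
    by (subst (1 2) e1) (auto intro!: nn_integral_cong split: split_indicator)
  moreover have "emeasure ?M2 (A \<inter> {-1<..<1}) = emeasure ?M2 A"
    by (subst (1 2) e2) (auto intro!: nn_integral_cong split: split_indicator)
  ultimately show "emeasure ?M1 A = emeasure ?M2 A" by simp
qed simp

lemma nn_integral_cos_of_cot:
  assumes [measurable]: "K \<in> borel_measurable borel"
  shows "(\<integral>\<^sup>+v. ennreal ((1 / sqrt (1 + v\<^sup>2)) ^ d) * K (cos_of_cot v) \<partial>lborel) =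
    (\<integral>\<^sup>+u. ennreal (axial_weight d u) * indicator {-1<..<1} u * K u \<partial>lborel)"
proof -
  have "(\<integral>\<^sup>+v. ennreal ((1 / sqrt (1 + v\<^sup>2)) ^ d) * K (cos_of_cot v) \<partial>lborel)
     = (\<integral>\<^sup>+u. K u \<partial>distr (density lborel (\<lambda>v. ennreal ((1 / sqrt (1 + v\<^sup>2)) ^ d))) borel cos_of_cot)"
    by (simp add: nn_integral_distr nn_integral_density)
  then show ?thesis unfolding distr_cos_of_cot by (simp add: nn_integral_density)
qed

section \<open>The surface measure in polar coordinates\<close>

lemma nn_integral_surface_measure:
  fixes h :: "real^'n \<Rightarrow> ennreal"
  assumes [measurable]: "h \<in> borel_measurable borel"
  shows "(\<integral>\<^sup>+z. h z \<partial>surface_measure) =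
    of_nat CARD('n) * (\<integral>\<^sup>+x. indicator (ball 0 1 - {0}) x * h (x /\<^sub>R norm x) \<partial>lborel)"
proof -
  have [measurable]: "h \<in> borel_measurable (restrict_space borel unit_sphere)"
    by (rule measurable_restrict_space1) simp
  show ?thesis
    unfolding surface_measure_def
    by (subst nn_integral_scale_measure, measurable)
      (subst nn_integral_distr[OF radial_projection_measurable],
        auto simp: nn_integral_restrict_space mult.commute)
qed

text \<open>
  The axis is a null set in dimension at least two: the segment of the axis inside the slab
  is invariant under the dilations of the hyperplane, so its finite measure is multiplied
  by \<open>2 ^ (d - 1)\<close> and stays the same.
\<close>
lemma AE_strip_perp_nonzero:
  fixes \<theta> :: "'a::euclidean_space"
  assumes \<theta>: "norm \<theta> = 1" and d: "2 \<le> DIM('a)"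
  shows "AE x in lborel. x \<bullet> \<theta> \<in> {0..1} \<longrightarrow> perp \<theta> x \<noteq> 0"
proof -
  define I where "I = (\<integral>\<^sup>+x. indicator {0..1} (x \<bullet> \<theta>) * indicator {0} (perp \<theta> x) \<partial>lborel)"
  have "I \<le> (\<integral>\<^sup>+x. indicator (cball 0 1) x \<partial>(lborel :: 'a measure))"
    unfolding I_def
  proof (rule nn_integral_mono)
    fix x :: 'a
    show "indicator {0..1} (x \<bullet> \<theta>) * indicator {0} (perp \<theta> x) \<le> (indicator (cball 0 1) x :: ennreal)"
    proof (cases "x \<bullet> \<theta> \<in> {0..1} \<and> perp \<theta> x = 0")
      case True
      then have "x = (x \<bullet> \<theta>) *\<^sub>R \<theta>" by simp
      then have "norm x = \<bar>x \<bullet> \<theta>\<bar>" using \<theta> by (metis norm_scaleR mult.right_neutral)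
      with True have "x \<in> cball 0 1" by simp
      then show ?thesis by (simp add: indicator_def)
    qed (auto split: split_indicator)
  qed
  also have "\<dots> < \<infinity>" using emeasure_lborel_cball_finite[of "0::'a" 1] by simp
  finally have fin: "I < \<infinity>" .
  have "I = ennreal (2 ^ (DIM('a) - 1)) *
      (\<integral>\<^sup>+x. indicator {0..1} (x \<bullet> \<theta>) * indicator {0} (2 *\<^sub>R perp \<theta> x) \<partial>lborel)"
    unfolding I_def by (rule nn_integral_strip_scale[OF _ \<theta>]) auto
  also have "(\<integral>\<^sup>+x. indicator {0..1} (x \<bullet> \<theta>) * indicator {0} (2 *\<^sub>R perp \<theta> x) \<partial>lborel) = I"
    unfolding I_def by (intro nn_integral_cong) (auto split: split_indicator)
  finally have I2: "I = ennreal (2 ^ (DIM('a) - 1)) * I" .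
  have "I = 0"
  proof (rule ccontr)
    assume "I \<noteq> 0"
    obtain i where i: "I = ennreal i" "0 \<le> i" using fin by (cases I) auto
    with \<open>I \<noteq> 0\<close> have "0 < i" by auto
    have "i = 2 ^ (DIM('a) - 1) * i" using I2 i by (simp add: ennreal_mult[symmetric])
    with \<open>0 < i\<close> have "(2::real) ^ (DIM('a) - 1) = 1" by simp
    moreover have "1 < (2::real) ^ (DIM('a) - 1)" using d by (intro one_less_power) auto
    ultimately show False by simp
  qed
  then have "AE x in lborel. indicator {0..1} (x \<bullet> \<theta>) * indicator {0} (perp \<theta> x) = (0::ennreal)"
    unfolding I_def by (subst (asm) nn_integral_0_iff_AE) auto
  then show ?thesis by eventually_elim (auto split: split_indicator_asm)
qed

definition polar_point :: "'a::euclidean_space \<Rightarrow> real \<Rightarrow> 'a \<Rightarrow> 'a" where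
  "polar_point \<theta> u w = u *\<^sub>R \<theta> + sqrt (1 - u\<^sup>2) *\<^sub>R w"

lemma polar_point_measurable [measurable (raw)]:
  assumes [measurable]: "f \<in> borel_measurable M" "g \<in> borel_measurable M"
  shows "(\<lambda>x. polar_point \<theta> (f x) (g x)) \<in> borel_measurable M"
  unfolding polar_point_def by measurable

text \<open>
  Heights over a point \<open>y\<close> of the hyperplane are measured in multiples of \<open>norm y\<close>. In this unit
  the latitude of the projected point depends on the multiple alone and its meridian on the direction
  of \<open>y\<close> alone, which is what makes the surface measure a product.
\<close>
lemma radial_projection_meridian:
  fixes \<theta> :: "'a::euclidean_space"
  assumes \<theta>: "norm \<theta> = 1" and y: "y \<bullet> \<theta> = 0" "y \<noteq> 0"
  shows "norm (y + (norm y * v) *\<^sub>R \<theta>) = norm y * sqrt (1 + v\<^sup>2)"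
    and "(y + (norm y * v) *\<^sub>R \<theta>) /\<^sub>R norm (y + (norm y * v) *\<^sub>R \<theta>) =
      polar_point \<theta> (cos_of_cot v) (y /\<^sub>R norm y)"
proof -
  have \<theta>\<theta>: "\<theta> \<bullet> \<theta> = 1" using \<theta> by (simp add: norm_eq_1)
  have p: "0 < 1 + v\<^sup>2" by (rule one_plus_square_pos)
  have "(norm (y + (norm y * v) *\<^sub>R \<theta>))\<^sup>2 = (norm y)\<^sup>2 * (1 + v\<^sup>2)"
    using y unfolding power2_norm_eq_inner
    by (simp add: inner_add_left inner_add_right inner_commute[of \<theta> y] \<theta>\<theta>)
      (simp add: power2_norm_eq_inner[symmetric] power2_eq_square algebra_simps)
  also have "\<dots> = (norm y * sqrt (1 + v\<^sup>2))\<^sup>2" using p by (simp add: power_mult_distrib)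
  finally show n: "norm (y + (norm y * v) *\<^sub>R \<theta>) = norm y * sqrt (1 + v\<^sup>2)"
    using p by (subst (asm) power2_eq_iff_nonneg) auto
  have s: "sqrt (1 - (cos_of_cot v)\<^sup>2) = 1 / sqrt (1 + v\<^sup>2)"
    using p unfolding sin_of_cot by simp
  have "norm y \<noteq> 0" using y by simp
  then show "(y + (norm y * v) *\<^sub>R \<theta>) /\<^sub>R norm (y + (norm y * v) *\<^sub>R \<theta>) =
      polar_point \<theta> (cos_of_cot v) (y /\<^sub>R norm y)"
    unfolding n polar_point_def s using p
    by (simp add: cos_of_cot_def scaleR_add_right divide_simps)
qed

text \<open>
  The surface measure of the equator up to a constant factor: the law of the direction of the
  orthogonal part. The factor \<open>norm\<close> in the density is the Jacobian of measuring heights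
  in units of the distance from the axis.
\<close>
definition meridian_measure :: "'a::euclidean_space \<Rightarrow> 'a measure" where
  "meridian_measure \<theta> = distr (density lborel (\<lambda>x. of_nat DIM('a) * indicator {0..1} (x \<bullet> \<theta>) *
     (ennreal (norm (perp \<theta> x)) * indicator {..<1} (norm (perp \<theta> x))))) borel
     (\<lambda>x. perp \<theta> x /\<^sub>R norm (perp \<theta> x))"

lemma sets_meridian_measure [simp, measurable_cong]: "sets (meridian_measure \<theta>) = sets borel"
  by (simp add: meridian_measure_def)

lemma space_meridian_measure [simp]: "space (meridian_measure \<theta>) = UNIV"
  by (simp add: meridian_measure_def)

lemma nn_integral_meridian_measure:
  fixes \<theta> :: "'a::euclidean_space"
  assumes [measurable]: "h \<in> borel_measurable borel"
  shows "(\<integral>\<^sup>+w. h w \<partial>meridian_measure \<theta>) = of_nat DIM('a) *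
    (\<integral>\<^sup>+x. indicator {0..1} (x \<bullet> \<theta>) * (ennreal (norm (perp \<theta> x)) * (indicator {..<1} (norm (perp \<theta> x)) *
       h (perp \<theta> x /\<^sub>R norm (perp \<theta> x)))) \<partial>lborel)"
  unfolding meridian_measure_def
  by (simp add: nn_integral_distr nn_integral_density nn_integral_cmult[symmetric])
   (auto intro!: nn_integral_cong simp: ac_simps)

lemma AE_meridian_measure:
  fixes \<theta> :: "'a::euclidean_space"
  assumes \<theta>: "norm \<theta> = 1"
  shows "AE w in meridian_measure \<theta>. norm w = 1 \<and> w \<bullet> \<theta> = 0"
proof -
  have \<theta>\<theta>: "\<theta> \<bullet> \<theta> = 1" using \<theta> by (simp add: norm_eq_1)
  have unit: "norm (perp \<theta> x /\<^sub>R norm (perp \<theta> x)) = 1 \<and> (perp \<theta> x /\<^sub>R norm (perp \<theta> x)) \<bullet> \<theta> = 0"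
    if "perp \<theta> x \<noteq> 0" for x
  proof -
    have "perp \<theta> x \<bullet> \<theta> = 0" by (simp add: inner_diff_left \<theta>\<theta>)
    with that show ?thesis by (simp only: norm_scaleR inner_scaleR_left) simp
  qed
  have "AE x in lborel. 0 < of_nat DIM('a) * indicator {0..1} (x \<bullet> \<theta>) *
     (ennreal (norm (perp \<theta> x)) * indicator {..<1} (norm (perp \<theta> x))) \<longrightarrow>
     norm (perp \<theta> x /\<^sub>R norm (perp \<theta> x)) = 1 \<and> (perp \<theta> x /\<^sub>R norm (perp \<theta> x)) \<bullet> \<theta> = 0"
  proof (rule AE_I2, rule impI)
    fix x
    assume "0 < of_nat DIM('a) * indicator {0..1} (x \<bullet> \<theta>) *
     (ennreal (norm (perp \<theta> x)) * indicator {..<1} (norm (perp \<theta> x)))"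
    then have "perp \<theta> x \<noteq> 0" by (metis ennreal_0 less_irrefl mult_zero_left mult_zero_right norm_zero)
    then show "norm (perp \<theta> x /\<^sub>R norm (perp \<theta> x)) = 1 \<and> (perp \<theta> x /\<^sub>R norm (perp \<theta> x)) \<bullet> \<theta> = 0"
      by (rule unit)
  qed
  then show ?thesis
    unfolding meridian_measure_def
    by (subst AE_distr_iff, simp, simp, subst AE_density, simp_all)
qed

text \<open>
  For a fixed slope \<open>v\<close> the unit ball cuts out the points at distance less than
  \<open>s = 1 / sqrt (1 + v\<^sup>2)\<close> from the axis. A dilation by \<open>s\<close> reduces this to distance less than \<open>1\<close> and
  contributes \<open>s ^ (d - 1)\<close>, one more factor \<open>s\<close> coming from the Jacobian; the resulting \<open>s ^ d dv\<close> is
  the angular weight in the variable \<open>u\<close>.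
\<close>
lemma nn_integral_surface_measure_polar:
  fixes h :: "real^'n \<Rightarrow> ennreal"
  assumes [measurable]: "h \<in> borel_measurable borel"
    and \<theta>: "norm \<theta> = 1" and d: "2 \<le> CARD('n)"
  shows "(\<integral>\<^sup>+z. h z \<partial>surface_measure) =
    (\<integral>\<^sup>+u. ennreal (axial_weight CARD('n) u) * indicator {-1<..<1} u *
       (\<integral>\<^sup>+w. h (polar_point \<theta> u w) \<partial>meridian_measure \<theta>) \<partial>lborel)"
proof -
  let ?d = "CARD('n)"
  let ?om = "\<lambda>x. perp \<theta> x /\<^sub>R norm (perp \<theta> x)"
  have \<theta>\<theta>: "\<theta> \<bullet> \<theta> = 1" using \<theta> by (simp add: norm_eq_1)
  define s where "s = (\<lambda>v::real. 1 / sqrt (1 + v\<^sup>2))"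
  have s: "0 < s v" for v using one_plus_square_pos[of v] by (simp add: s_def)
  have [measurable]: "s \<in> borel_measurable borel" unfolding s_def by measurable
  define H where "H = (\<lambda>x. indicator (ball 0 1 - {0}) x * h (x /\<^sub>R norm x))"
  have [measurable]: "ball 0 1 - {0} \<in> sets (borel :: (real^'n) measure)" by auto
  have [measurable]: "H \<in> borel_measurable borel" unfolding H_def by measurable
  define K where "K = (\<lambda>u. \<integral>\<^sup>+w. h (polar_point \<theta> u w) \<partial>meridian_measure \<theta>)"
  \<comment> \<open>The integrand over the line through \<open>y\<close> after substituting \<open>norm y * v\<close> for the height.\<close>
  define g where "g = (\<lambda>v y. ennreal (norm y) * (indicator {..<1} (norm y / s v) *
      h (polar_point \<theta> (cos_of_cot v) (y /\<^sub>R norm y))))"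
  define X where "X = (\<lambda>v. \<integral>\<^sup>+x. indicator {0..1} (x \<bullet> \<theta>) *
       (ennreal (norm (perp \<theta> x)) * (indicator {..<1} (norm (perp \<theta> x)) *
       h (polar_point \<theta> (cos_of_cot v) (?om x)))) \<partial>lborel)"
  have "(\<integral>\<^sup>+x. H x \<partial>lborel) =
    (\<integral>\<^sup>+x. indicator {0..1} (x \<bullet> \<theta>) * (\<integral>\<^sup>+t. H (perp \<theta> x + t *\<^sub>R \<theta>) \<partial>lborel) \<partial>lborel)"
    by (rule nn_integral_lborel_slices[OF _ \<theta>]) simp
  also have "\<dots> = (\<integral>\<^sup>+x. (\<integral>\<^sup>+v. indicator {0..1} (x \<bullet> \<theta>) * g v (perp \<theta> x) \<partial>lborel) \<partial>lborel)"
  proof (rule nn_integral_cong_AE)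
    have "AE x in lborel. x \<bullet> \<theta> \<in> {0..1} \<longrightarrow> perp \<theta> x \<noteq> 0"
      by (rule AE_strip_perp_nonzero[OF \<theta>]) (use d in simp)
    then show "AE x in lborel. indicator {0..1} (x \<bullet> \<theta>) * (\<integral>\<^sup>+t. H (perp \<theta> x + t *\<^sub>R \<theta>) \<partial>lborel) =
       (\<integral>\<^sup>+v. indicator {0..1} (x \<bullet> \<theta>) * g v (perp \<theta> x) \<partial>lborel)"
    proof eventually_elim
      fix x assume x: "x \<bullet> \<theta> \<in> {0..1} \<longrightarrow> perp \<theta> x \<noteq> 0"
      show "indicator {0..1} (x \<bullet> \<theta>) * (\<integral>\<^sup>+t. H (perp \<theta> x + t *\<^sub>R \<theta>) \<partial>lborel) =
       (\<integral>\<^sup>+v. indicator {0..1} (x \<bullet> \<theta>) * g v (perp \<theta> x) \<partial>lborel)"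
      proof (cases "x \<bullet> \<theta> \<in> {0..1}")
        case True
        define y where "y = perp \<theta> x"
        have y: "y \<bullet> \<theta> = 0" "y \<noteq> 0" using x True by (auto simp: y_def inner_diff_left \<theta>\<theta>)
        have "(\<integral>\<^sup>+t. H (y + t *\<^sub>R \<theta>) \<partial>lborel) =
            ennreal (norm y) * (\<integral>\<^sup>+v. H (y + (norm y * v) *\<^sub>R \<theta>) \<partial>lborel)"
          using y by (subst nn_integral_real_affine[where t = 0 and c = "norm y"]) auto
        also have "\<dots> = (\<integral>\<^sup>+v. ennreal (norm y) * H (y + (norm y * v) *\<^sub>R \<theta>) \<partial>lborel)"
          by (rule nn_integral_cmult[symmetric]) measurable
        also have "\<dots> = (\<integral>\<^sup>+v. g v y \<partial>lborel)"
        proof (rule nn_integral_cong)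
          fix v
          have "indicator (ball 0 1 - {0}) (y + (norm y * v) *\<^sub>R \<theta>)
              = (indicator {..<1} (norm (y + (norm y * v) *\<^sub>R \<theta>)) :: ennreal)"
            using radial_projection_meridian(1)[OF \<theta> y, of v] y one_plus_square_pos[of v]
            by (auto split: split_indicator)
          then show "ennreal (norm y) * H (y + (norm y * v) *\<^sub>R \<theta>) = g v y"
            unfolding H_def g_def radial_projection_meridian(2)[OF \<theta> y]
            by (simp add: s_def radial_projection_meridian(1)[OF \<theta> y])
        qed
        finally show ?thesis using True by (simp add: y_def)
      qed simp
    qed
  qed
  also have "\<dots> = (\<integral>\<^sup>+v. (\<integral>\<^sup>+x. indicator {0..1} (x \<bullet> \<theta>) * g v (perp \<theta> x) \<partial>lborel) \<partial>lborel)"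
    unfolding g_def by (rule lborel_pair.Fubini') measurable
  also have "of_nat ?d * \<dots> = (\<integral>\<^sup>+v. ennreal (s v ^ ?d) * K (cos_of_cot v) \<partial>lborel)"
  proof (subst nn_integral_cmult[symmetric], simp add: g_def, rule nn_integral_cong)
    fix v :: real
    have sc: "g v (s v *\<^sub>R y) = ennreal (s v) * (ennreal (norm y) * (indicator {..<1} (norm y) *
       h (polar_point \<theta> (cos_of_cot v) (y /\<^sub>R norm y))))" for y
    proof -
      have "(s v *\<^sub>R y) /\<^sub>R norm (s v *\<^sub>R y) = y /\<^sub>R norm y" using s[of v] by simp
      moreover have "norm (s v *\<^sub>R y) = s v * norm y" using s[of v] by simp
      moreover have "s v * norm y / s v = norm y" using s[of v] by simp
      ultimately show ?thesis
        using s[of v] unfolding g_def by (simp only: ennreal_mult less_imp_le norm_ge_zero mult.assoc)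
    qed
    have "(\<integral>\<^sup>+x. indicator {0..1} (x \<bullet> \<theta>) * g v (perp \<theta> x) \<partial>lborel) = ennreal (s v ^ (DIM(real^'n) - 1)) *
       (\<integral>\<^sup>+x. indicator {0..1} (x \<bullet> \<theta>) * g v (s v *\<^sub>R perp \<theta> x) \<partial>lborel)"
      by (rule nn_integral_strip_scale[OF _ \<theta> s]) (simp add: g_def)
    also have "\<dots> = ennreal (s v ^ (?d - 1)) * (ennreal (s v) * X v)"
      unfolding sc X_def by (subst nn_integral_cmult[symmetric]) (auto simp: mult.left_commute)
    also have "\<dots> = ennreal (s v ^ ?d) * X v"
    proof -
      have "s v ^ (?d - 1) * s v = s v ^ ?d" using d by (simp flip: power_Suc2)
      then show ?thesis using s[of v] by (simp add: ennreal_mult'[symmetric] mult.assoc[symmetric])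
    qed
    also have "of_nat ?d * (ennreal (s v ^ ?d) * X v) = ennreal (s v ^ ?d) * K (cos_of_cot v)"
      unfolding K_def X_def by (subst nn_integral_meridian_measure) (auto simp: mult.left_commute)
    finally show "of_nat ?d * (\<integral>\<^sup>+x. indicator {0..1} (x \<bullet> \<theta>) * g v (perp \<theta> x) \<partial>lborel)
      = ennreal (s v ^ ?d) * K (cos_of_cot v)" .
  qed
  also have "\<dots> = (\<integral>\<^sup>+u. ennreal (axial_weight ?d u) * indicator {-1<..<1} u * K u \<partial>lborel)"
    unfolding s_def
  proof (rule nn_integral_cos_of_cot)
    have "K = (\<lambda>u. of_nat DIM(real^'n) *
    (\<integral>\<^sup>+x. indicator {0..1} (x \<bullet> \<theta>) * (ennreal (norm (perp \<theta> x)) * (indicator {..<1} (norm (perp \<theta> x)) *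
       h (polar_point \<theta> u (?om x)))) \<partial>lborel))"
      unfolding K_def by (intro ext nn_integral_meridian_measure) measurable
    also have "\<dots> \<in> borel_measurable borel" by measurable
    finally show "K \<in> borel_measurable borel" .
  qed
  finally show ?thesis
    unfolding nn_integral_surface_measure[OF assms(1)] H_def K_def .
qed

section \<open>Null sets of the surface measure\<close>

lemma emeasure_lborel_open_nonzero:
  fixes S :: "'a::euclidean_space set"
  assumes "open S" "S \<noteq> {}" shows "emeasure lborel S \<noteq> 0"
proof
  assume "emeasure lborel S = 0"
  then have "S \<in> null_sets lborel" using assms by (auto simp: null_sets_def)
  then have "negligible S" by (simp add: negligible_iff_null_sets null_sets_completionI)
  with open_not_negligible[OF assms] show False by simp
qed

lemma emeasure_surface_measure_sphere:
  "emeasure surface_measure (unit_sphere :: (real^'n) set) \<noteq> 0"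
  "emeasure surface_measure (unit_sphere :: (real^'n) set) < \<infinity>"
proof -
  have eq: "{x::real^'n. 0 < norm x \<and> norm x < 1 \<and> x /\<^sub>R norm x \<in> unit_sphere} = ball 0 1 - {0}"
    by auto
  have e: "emeasure surface_measure (unit_sphere :: (real^'n) set) =
      of_nat CARD('n) * emeasure lborel (ball 0 1 - {0} :: (real^'n) set)"
    using emeasure_surface_measure[of "unit_sphere :: (real^'n) set"] unfolding eq by simp
  have "emeasure lborel (ball 0 1 - {0} :: (real^'n) set) = emeasure lborel (ball 0 1 :: (real^'n) set)"
    by (rule emeasure_Diff_null_set) auto
  moreover have "emeasure lborel (ball 0 1 :: (real^'n) set) < \<infinity>"
    by (rule emeasure_lborel_ball_finite)
  moreover have "emeasure lborel (ball 0 1 :: (real^'n) set) \<noteq> 0"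
    by (rule emeasure_lborel_open_nonzero) auto
  ultimately show "emeasure surface_measure (unit_sphere :: (real^'n) set) \<noteq> 0"
    "emeasure surface_measure (unit_sphere :: (real^'n) set) < \<infinity>"
    unfolding e by (auto simp: ennreal_mult_less_top of_nat_less_top)
qed

text \<open>
  The set where two continuous functions differ is relatively open, and the cone over a nonempty
  relatively open set is a nonempty open set of the space.
\<close>
lemma AE_surface_measure_continuous_eq:
  fixes G H :: "real^'n \<Rightarrow> 'b::real_normed_vector"
  assumes G: "continuous_on unit_sphere G" and H: "continuous_on unit_sphere H"
    and ae: "AE z in surface_measure. G z = H z" and z: "z \<in> unit_sphere"
  shows "G z = H z"
proof (rule ccontr)
  assume neq: "G z \<noteq> H z"
  define U where "U = {x \<in> unit_sphere. G x \<noteq> H x}"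
  have "closedin (top_of_set unit_sphere) {x \<in> unit_sphere. G x = H x}"
    using continuous_closedin_preimage_constant[OF continuous_on_diff[OF G H], of 0] by simp
  then have "openin (top_of_set unit_sphere) (unit_sphere - {x \<in> unit_sphere. G x = H x})"
    by (intro openin_diff) auto
  moreover have "unit_sphere - {x \<in> unit_sphere. G x = H x} = U" by (auto simp: U_def)
  ultimately obtain V where V: "open V" "U = unit_sphere \<inter> V" by (auto simp: openin_open)
  have Ub: "U \<in> sets borel" using V by auto
  let ?C = "{x::real^'n. 0 < norm x \<and> norm x < 1 \<and> x /\<^sub>R norm x \<in> U}"
  have C: "?C = (ball 0 1 - {0}) \<inter> (\<lambda>x. x /\<^sub>R norm x) -` V"
    by (auto simp: V)
  have "open ((ball 0 1 - {0}) \<inter> (\<lambda>x::real^'n. x /\<^sub>R norm x) -` V)"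
    by (intro continuous_open_preimage V(1) continuous_intros) auto
  then have "open ?C" unfolding C .
  moreover have "(1/2) *\<^sub>R z \<in> ?C" using z neq by (auto simp: U_def)
  ultimately have "emeasure lborel ?C \<noteq> 0" by (intro emeasure_lborel_open_nonzero) blast+
  then have "emeasure surface_measure U \<noteq> 0"
    using Ub V by (subst emeasure_surface_measure) auto
  moreover have "emeasure surface_measure U = 0"
  proof -
    have "{x \<in> space surface_measure. \<not> G x = H x} = U" by (auto simp: U_def)
    moreover have "U \<in> sets surface_measure" using Ub V by (auto simp: sets_restrict_space)
    ultimately show ?thesis using ae by (simp add: AE_iff_measurable[of U])
  qed
  ultimately show False by simp
qed

section \<open>Colatitude, geodesic distance and maps along meridians\<close>

lemma inner_perp: "norm \<theta> = 1 \<Longrightarrow> perp \<theta> z \<bullet> \<theta> = 0"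
  by (simp add: inner_diff_left norm_eq_1)

lemma norm_perp:
  assumes "norm \<theta> = 1" "norm z = 1"
  shows "norm (perp \<theta> z) = sqrt (1 - (z \<bullet> \<theta>)\<^sup>2)"
proof -
  have "perp \<theta> z \<bullet> perp \<theta> z = 1 - (z \<bullet> \<theta>)\<^sup>2"
    using assms by (simp add: inner_diff_left inner_diff_right norm_eq_1 inner_commute[of \<theta> z] power2_eq_square)
  then show ?thesis by (simp add: norm_eq_sqrt_inner)
qed

lemma inner_unit_bounds:
  assumes "norm x = 1" "norm y = 1" shows "x \<bullet> y \<in> {-1..1}"
  using Cauchy_Schwarz_ineq2[of x y] assms by (simp add: abs_le_iff)

text \<open>
  At the poles the direction is \<open>0\<close>, but there its coefficient vanishes too.
\<close>
lemma polar_point_latitude_sign: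
  fixes \<theta> :: "real^'n"
  assumes "norm \<theta> = 1" "norm z = 1"
  shows "polar_point \<theta> (z \<bullet> \<theta>) (directional_sign \<theta> z) = z"
proof (cases "perp \<theta> z = 0")
  case True
  then show ?thesis by (simp add: polar_point_def directional_sign_def)
next
  case False
  then show ?thesis
    unfolding polar_point_def directional_sign_def norm_perp[OF assms, symmetric] by simp
qed

lemma polar_point_facts:
  fixes \<theta> w :: "'a::euclidean_space"
  assumes \<theta>: "norm \<theta> = 1" and w: "norm w = 1" "w \<bullet> \<theta> = 0" and u: "u \<in> {-1..1}"
  shows inner_polar_point: "polar_point \<theta> u w \<bullet> \<theta> = u"
    and perp_polar_point: "perp \<theta> (polar_point \<theta> u w) = sqrt (1 - u\<^sup>2) *\<^sub>R w"
    and norm_polar_point: "norm (polar_point \<theta> u w) = 1"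
proof -
  have \<theta>\<theta>: "\<theta> \<bullet> \<theta> = 1" "w \<bullet> w = 1" using \<theta> w by (auto simp: norm_eq_1)
  have u2: "u\<^sup>2 \<le> 1" using u by (simp add: abs_square_le_1 abs_le_iff)
  show i: "polar_point \<theta> u w \<bullet> \<theta> = u"
    using w \<theta>\<theta> by (simp add: polar_point_def inner_add_left)
  show "perp \<theta> (polar_point \<theta> u w) = sqrt (1 - u\<^sup>2) *\<^sub>R w"
    unfolding i by (simp add: polar_point_def)
  have "polar_point \<theta> u w \<bullet> polar_point \<theta> u w = 1"
    using w \<theta>\<theta> u2
    by (simp add: polar_point_def inner_add_left inner_add_right inner_commute[of \<theta> w] power2_eq_square[symmetric])
  then show "norm (polar_point \<theta> u w) = 1" by (simp add: norm_eq_1)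
qed

lemma directional_sign_polar_point:
  fixes \<theta> w :: "real^'n"
  assumes "norm \<theta> = 1" "norm w = 1" "w \<bullet> \<theta> = 0" and u: "u \<in> {-1<..<1}"
  shows "directional_sign \<theta> (polar_point \<theta> u w) = w"
proof -
  have "0 < sqrt (1 - u\<^sup>2)" using u by (simp add: abs_square_less_1 abs_less_iff)
  then show ?thesis
    unfolding directional_sign_def using perp_polar_point[OF assms(1-3), of u] u assms by simp
qed

lemma directional_sign_unit:
  fixes \<theta> :: "real^'n"
  assumes "norm \<theta> = 1" "perp \<theta> z \<noteq> 0"
  shows "norm (directional_sign \<theta> z) = 1" "directional_sign \<theta> z \<bullet> \<theta> = 0"
  using assms(2) inner_perp[OF assms(1), of z] by (simp_all add: directional_sign_def)

definition colatitude :: "'a::euclidean_space \<Rightarrow> 'a \<Rightarrow> real" where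
  "colatitude \<theta> z = arccos (z \<bullet> \<theta>)"

lemma colatitude_bounds:
  "norm \<theta> = 1 \<Longrightarrow> norm z = 1 \<Longrightarrow> colatitude \<theta> z \<in> {0..pi}"
  using inner_unit_bounds[of z \<theta>] by (simp add: colatitude_def arccos_lbound arccos_ubound)

lemma cos_arccos_diff:
  assumes "a \<in> {-1..1}" "b \<in> {-1..1}"
  shows "cos (arccos a - arccos b) = a * b + sqrt (1 - a\<^sup>2) * sqrt (1 - b\<^sup>2)"
  using assms by (simp add: cos_diff sin_arccos)

lemma arccos_cos_arccos_diff:
  assumes "a \<in> {-1..1}" "b \<in> {-1..1}"
  shows "arccos (cos (arccos a - arccos b)) = \<bar>arccos a - arccos b\<bar>"
  using assms arccos_lbound[of a] arccos_ubound[of a] arccos_lbound[of b] arccos_ubound[of b]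
  by (intro arccos_cos_eq_abs) auto

text \<open>
  By the Cauchy-Schwarz inequality for the orthogonal parts, \<open>y \<bullet> z\<close> is at most the cosine of
  the difference of the colatitudes. Equality makes the orthogonal parts parallel, that is, \<open>z\<close>
  lies on the meridian of \<open>y\<close>; for \<open>y\<close> a pole there is no distinguished meridian.
\<close>
lemma colatitude_diff_le_geodesic_dist:
  fixes \<theta> :: "real^'n"
  assumes \<theta>: "norm \<theta> = 1" and y: "norm y = 1" and z: "norm z = 1"
  shows "\<bar>colatitude \<theta> y - colatitude \<theta> z\<bar> \<le> geodesic_dist y z"
    and "\<bar>colatitude \<theta> y - colatitude \<theta> z\<bar> = geodesic_dist y z \<Longrightarrow> perp \<theta> y \<noteq> 0 \<Longrightarrow>
      z = polar_point \<theta> (z \<bullet> \<theta>) (directional_sign \<theta> y)"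
proof -
  let ?a = "y \<bullet> \<theta>" and ?b = "z \<bullet> \<theta>"
  have ab: "?a \<in> {-1..1}" "?b \<in> {-1..1}" "y \<bullet> z \<in> {-1..1}"
    using inner_unit_bounds \<theta> y z by blast+
  have split: "y \<bullet> z = ?a * ?b + perp \<theta> y \<bullet> perp \<theta> z"
    using \<theta> by (simp add: inner_diff_left inner_diff_right norm_eq_1 inner_commute[of \<theta> y] inner_commute[of \<theta> z])
  have cs: "perp \<theta> y \<bullet> perp \<theta> z \<le> norm (perp \<theta> y) * norm (perp \<theta> z)"
    by (rule norm_cauchy_schwarz)
  have cosd: "cos (arccos ?a - arccos ?b) = ?a * ?b + norm (perp \<theta> y) * norm (perp \<theta> z)"
    unfolding cos_arccos_diff[OF ab(1,2)] norm_perp[OF \<theta> y] norm_perp[OF \<theta> z] ..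
  have "y \<bullet> z \<le> cos (arccos ?a - arccos ?b)" using split cs cosd by simp
  then have "arccos (cos (arccos ?a - arccos ?b)) \<le> arccos (y \<bullet> z)"
    using ab by (intro arccos_le_arccos) auto
  then show "\<bar>colatitude \<theta> y - colatitude \<theta> z\<bar> \<le> geodesic_dist y z"
    unfolding arccos_cos_arccos_diff[OF ab(1,2)] by (simp add: colatitude_def geodesic_dist_def)
  assume eq: "\<bar>colatitude \<theta> y - colatitude \<theta> z\<bar> = geodesic_dist y z" and py: "perp \<theta> y \<noteq> 0"
  have "arccos (cos (arccos ?a - arccos ?b)) = arccos (y \<bullet> z)"
    unfolding arccos_cos_arccos_diff[OF ab(1,2)] using eq by (simp add: colatitude_def geodesic_dist_def)
  then have "cos (arccos (cos (arccos ?a - arccos ?b))) = cos (arccos (y \<bullet> z))" by simp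
  then have "cos (arccos ?a - arccos ?b) = y \<bullet> z" using ab by simp
  then have "perp \<theta> y \<bullet> perp \<theta> z = norm (perp \<theta> y) * norm (perp \<theta> z)" using split cosd by simp
  then have "norm (perp \<theta> y) *\<^sub>R perp \<theta> z = norm (perp \<theta> z) *\<^sub>R perp \<theta> y"
    by (simp only: norm_cauchy_schwarz_eq)
  then have "inverse (norm (perp \<theta> y)) *\<^sub>R norm (perp \<theta> y) *\<^sub>R perp \<theta> z
      = inverse (norm (perp \<theta> y)) *\<^sub>R norm (perp \<theta> z) *\<^sub>R perp \<theta> y" by (simp only:)
  then have "perp \<theta> z = norm (perp \<theta> z) *\<^sub>R directional_sign \<theta> y"
    using py by (simp add: directional_sign_def mult.commute)
  then have "z = ?b *\<^sub>R \<theta> + norm (perp \<theta> z) *\<^sub>R directional_sign \<theta> y"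
    by (simp add: algebra_simps)
  then show "z = polar_point \<theta> (z \<bullet> \<theta>) (directional_sign \<theta> y)"
    unfolding polar_point_def norm_perp[OF \<theta> z] .
qed

definition meridian_map :: "real^'n \<Rightarrow> (real \<Rightarrow> real) \<Rightarrow> real^'n \<Rightarrow> real^'n" where
  "meridian_map \<theta> m z = polar_point \<theta> (m (z \<bullet> \<theta>)) (directional_sign \<theta> z)"

lemma pole_latitude:
  assumes "norm \<theta> = 1" "norm z = 1" "perp \<theta> z = 0"
  shows "z \<bullet> \<theta> = 1 \<or> z \<bullet> \<theta> = -1"
proof -
  have "(z \<bullet> \<theta>)\<^sup>2 = 1" using norm_perp[OF assms(1,2)] assms(3) by simp
  then show ?thesis by (simp add: power2_eq_1_iff)
qed

lemma meridian_map_facts: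
  fixes \<theta> :: "real^'n"
  assumes \<theta>: "norm \<theta> = 1" and z: "norm z = 1"
    and m: "m (z \<bullet> \<theta>) \<in> {-1..1}" "m 1 = 1" "m (-1) = -1"
  shows norm_meridian_map: "norm (meridian_map \<theta> m z) = 1"
    and inner_meridian_map: "meridian_map \<theta> m z \<bullet> \<theta> = m (z \<bullet> \<theta>)"
    and geodesic_dist_meridian_map:
      "geodesic_dist z (meridian_map \<theta> m z) = \<bar>arccos (z \<bullet> \<theta>) - arccos (m (z \<bullet> \<theta>))\<bar>"
proof -
  let ?a = "z \<bullet> \<theta>"
  have "norm (meridian_map \<theta> m z) = 1 \<and> meridian_map \<theta> m z \<bullet> \<theta> = m ?a \<and>
     geodesic_dist z (meridian_map \<theta> m z) = \<bar>arccos ?a - arccos (m ?a)\<bar>"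
  proof (cases "perp \<theta> z = 0")
    case True
    then have ma: "m ?a = ?a" using pole_latitude[OF \<theta> z] m by auto
    have "meridian_map \<theta> m z = z"
      unfolding meridian_map_def ma by (rule polar_point_latitude_sign[OF \<theta> z])
    then show ?thesis using z ma by (simp add: geodesic_dist_def norm_eq_1)
  next
    case False
    let ?w = "directional_sign \<theta> z"
    note w = directional_sign_unit[OF \<theta> False]
    have a: "?a \<in> {-1..1}" using inner_unit_bounds[OF z \<theta>] .
    have pw: "perp \<theta> z \<bullet> ?w = norm (perp \<theta> z)"
      using False by (simp add: directional_sign_def power2_norm_eq_inner[symmetric] power2_eq_square)
    have zw: "z \<bullet> ?w = sqrt (1 - ?a\<^sup>2)"
      using pw w by (simp add: inner_diff_left inner_commute[of \<theta> "directional_sign \<theta> z"] norm_perp[OF \<theta> z])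
    have "z \<bullet> meridian_map \<theta> m z = cos (arccos ?a - arccos (m ?a))"
      unfolding cos_arccos_diff[OF a m(1)]
      by (simp add: meridian_map_def polar_point_def inner_add_right zw)
    then have "geodesic_dist z (meridian_map \<theta> m z) = \<bar>arccos ?a - arccos (m ?a)\<bar>"
      using arccos_cos_arccos_diff[OF a m(1)] by (simp add: geodesic_dist_def)
    then show ?thesis
      using norm_polar_point[OF \<theta> w m(1)] inner_polar_point[OF \<theta> w m(1)] by (simp add: meridian_map_def)
  qed
  then show "norm (meridian_map \<theta> m z) = 1" "meridian_map \<theta> m z \<bullet> \<theta> = m ?a"
     "geodesic_dist z (meridian_map \<theta> m z) = \<bar>arccos ?a - arccos (m ?a)\<bar>" by auto
qed

text \<open>
  The direction is discontinuous at the poles, but it is bounded and its coefficient tends to \<open>0\<close>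
  there because the poles are fixed.
\<close>
lemma continuous_on_meridian_map:
  fixes \<theta> :: "real^'n"
  assumes \<theta>: "norm \<theta> = 1" and cont: "continuous_on {-1..1} m"
    and m: "\<And>u. u \<in> {-1..1} \<Longrightarrow> m u \<in> {-1..1}" "m 1 = 1" "m (-1) = -1"
  shows "continuous_on unit_sphere (meridian_map \<theta> m)"
proof -
  have cm: "continuous_on unit_sphere (\<lambda>z. m (z \<bullet> \<theta>))"
  proof (rule continuous_on_compose2[OF cont])
    show "continuous_on unit_sphere (\<lambda>z. z \<bullet> \<theta>)" by (intro continuous_intros)
    show "(\<lambda>z. z \<bullet> \<theta>) ` unit_sphere \<subseteq> {-1..1}"
      using inner_unit_bounds[OF _ \<theta>] by (metis dist_0_norm image_subsetI mem_sphere)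
  qed
  have "continuous_on unit_sphere (\<lambda>z. sqrt (1 - (m (z \<bullet> \<theta>))\<^sup>2) *\<^sub>R directional_sign \<theta> z)"
    unfolding continuous_on_def
  proof
    fix z :: "real^'n" assume z: "z \<in> unit_sphere"
    let ?F = "at z within unit_sphere"
    have lim: "((\<lambda>x. m (x \<bullet> \<theta>)) \<longlongrightarrow> m (z \<bullet> \<theta>)) ?F"
      using cm z by (simp add: continuous_on_def)
    have limr: "((\<lambda>x. sqrt (1 - (m (x \<bullet> \<theta>))\<^sup>2)) \<longlongrightarrow> sqrt (1 - (m (z \<bullet> \<theta>))\<^sup>2)) ?F"
      by (intro tendsto_intros lim)
    show "((\<lambda>x. sqrt (1 - (m (x \<bullet> \<theta>))\<^sup>2) *\<^sub>R directional_sign \<theta> x)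
      \<longlongrightarrow> sqrt (1 - (m (z \<bullet> \<theta>))\<^sup>2) *\<^sub>R directional_sign \<theta> z) ?F"
    proof (cases "perp \<theta> z = 0")
      case False
      have "(directional_sign \<theta> \<longlongrightarrow> directional_sign \<theta> z) ?F"
        unfolding directional_sign_def[abs_def] using False by (intro tendsto_intros) auto
      with limr show ?thesis by (intro tendsto_scaleR)
    next
      case True
      then have "(m (z \<bullet> \<theta>))\<^sup>2 = 1" using pole_latitude[OF \<theta>, of z] z m by auto
      then have 0: "sqrt (1 - (m (z \<bullet> \<theta>))\<^sup>2) = 0" by simp
      have le: "norm (sqrt (1 - (m (x \<bullet> \<theta>))\<^sup>2) *\<^sub>R directional_sign \<theta> x) \<le> \<bar>sqrt (1 - (m (x \<bullet> \<theta>))\<^sup>2)\<bar>" for x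
      proof -
        have "norm (directional_sign \<theta> x) \<le> 1"
          by (cases "perp \<theta> x = 0") (auto simp: directional_sign_def)
        then show ?thesis by (simp add: mult_left_le)
      qed
      have "((\<lambda>x. \<bar>sqrt (1 - (m (x \<bullet> \<theta>))\<^sup>2)\<bar>) \<longlongrightarrow> 0) ?F"
        using tendsto_rabs[OF limr] 0 by simp
      then have "((\<lambda>x. sqrt (1 - (m (x \<bullet> \<theta>))\<^sup>2) *\<^sub>R directional_sign \<theta> x) \<longlongrightarrow> 0) ?F"
        by (rule Lim_null_comparison[rotated]) (use le in \<open>auto intro!: always_eventually\<close>)
      then show ?thesis using 0 by simp
    qed
  qed
  then show ?thesis
    unfolding meridian_map_def[abs_def] polar_point_def
    by (rule continuous_on_add[rotated]) (intro continuous_intros cm)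
qed

lemma meridian_map_measurable:
  fixes \<theta> :: "real^'n"
  assumes [measurable]: "(\<lambda>u. m u) \<in> borel_measurable borel"
  shows "meridian_map \<theta> m \<in> borel_measurable borel"
  unfolding meridian_map_def[abs_def] directional_sign_def by measurable

section \<open>Monotone transport between densities on an interval\<close>

definition normalized_cdf :: "(real \<Rightarrow> real) \<Rightarrow> real \<Rightarrow> real" where
  "normalized_cdf h u = (LBINT s:{-1..u}. h s) / (LBINT s:{-1..1}. h s)"

text \<open>
  The densities and transport maps of interest are specified on \<open>{-1..1}\<close> alone. Composition with
  the retraction onto this interval turns them into Borel functions on the whole line.
\<close>
definition clip :: "real \<Rightarrow> real" where "clip u = max (-1) (min 1 u)"

lemma clip_bounds: "clip u \<in> {-1..1}" by (auto simp: clip_def)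
lemma clip_ge [simp]: "-1 \<le> clip u" and clip_le [simp]: "clip u \<le> 1" by (auto simp: clip_def)
lemma clip_id [simp]: "u \<in> {-1..1} \<Longrightarrow> clip u = u" by (auto simp: clip_def)
lemma continuous_on_clip [continuous_intros]: "continuous_on S clip"
  unfolding clip_def[abs_def] by (intro continuous_intros)

locale axial_density =
  fixes h :: "real \<Rightarrow> real"
  assumes integrable: "set_integrable lborel {-1..1} h"
    and positive: "u \<in> {-1<..<1} \<Longrightarrow> 0 < h u"
    and nonneg: "u \<in> {-1..1} \<Longrightarrow> 0 \<le> h u"
begin

abbreviation mass :: real where "mass \<equiv> LBINT s:{-1..1}. h s"

definition law :: "real measure" where
  "law = density lborel (\<lambda>s. ennreal (indicator {-1..1} s * h s / mass))"

lemma measurable_density [measurable]: "(\<lambda>s. indicator {-1..1} s * h s) \<in> borel_measurable borel"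
  using integrable by (auto simp: set_integrable_def dest: borel_measurable_integrable)

lemma sub_integrable: "A \<in> sets borel \<Longrightarrow> A \<subseteq> {-1..1} \<Longrightarrow> set_integrable lborel A h"
  using set_integrable_subset[OF integrable] by simp

text \<open>
  Strict positivity inside the interval gives the distribution function a strict
  increase, hence an inverse.
\<close>
lemma positive_mass:
  assumes "a < b" "{a..b} \<subseteq> {-1..1}"
  shows "0 < (LBINT s:{a..b}. h s)"
proof -
  have int: "integrable lborel (\<lambda>s. indicator {a..b} s * h s)"
    using sub_integrable[of "{a..b}"] assms by (simp add: set_integrable_def)
  have nn: "AE s in lborel. 0 \<le> indicator {a..b} s * h s"
    using nonneg assms by (auto split: split_indicator)
  have "0 \<le> (LBINT s:{a..b}. h s)"
    unfolding set_lebesgue_integral_def using nonneg assms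
    by (intro Bochner_Integration.integral_nonneg) (auto split: split_indicator)
  moreover have "(LBINT s:{a..b}. h s) \<noteq> 0"
  proof
    assume "(LBINT s:{a..b}. h s) = 0"
    then have "AE s in lborel. indicator {a..b} s * h s = 0"
      unfolding set_lebesgue_integral_def
      using integral_nonneg_eq_0_iff_AE[OF int nn] by simp
    then have "AE s in lborel. s \<notin> {a<..<b}"
    proof eventually_elim
      fix s assume "indicator {a..b} s * h s = 0"
      moreover have "0 < h s" if "s \<in> {a<..<b}"
        using that assms by (intro positive) auto
      ultimately show "s \<notin> {a<..<b}" by (auto split: split_indicator_asm)
    qed
    then have "emeasure lborel {x. a < x \<and> x < b} = 0"
      by (subst (asm) AE_iff_measurable[OF _ refl]) auto
    moreover have "{a<..<b} = {x. a < x \<and> x < b}" by auto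
    ultimately have "emeasure lborel {a<..<b} = 0" by (simp only:)
    moreover have "emeasure lborel {a<..<b} = ennreal (b - a)" using assms by simp
    ultimately show False using assms by simp
  qed
  ultimately show ?thesis by simp
qed

lemma mass_pos: "0 < mass" by (rule positive_mass) auto

lemma emeasure_law:
  assumes [measurable]: "A \<in> sets borel"
  shows "emeasure law A = ennreal ((LBINT s:A \<inter> {-1..1}. h s) / mass)"
proof -
  have i: "integrable lborel (\<lambda>s. indicator (A \<inter> {-1..1}) s * h s)"
    using sub_integrable[of "A \<inter> {-1..1}"] by (simp add: set_integrable_def)
  have "emeasure law A = (\<integral>\<^sup>+s. ennreal (indicator (A \<inter> {-1..1}) s * h s / mass) \<partial>lborel)"
    unfolding law_def
    by (subst emeasure_density) (auto intro!: nn_integral_cong split: split_indicator)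
  also have "\<dots> = ennreal (\<integral>s. indicator (A \<inter> {-1..1}) s * h s / mass \<partial>lborel)"
    using nonneg mass_pos i
    by (intro nn_integral_eq_integral integrable_divide) (auto split: split_indicator)
  finally show ?thesis by (simp add: set_lebesgue_integral_def)
qed

lemma nn_integral_law:
  assumes [measurable]: "g \<in> borel_measurable borel"
  shows "(\<integral>\<^sup>+u. g u \<partial>law) = (\<integral>\<^sup>+u. ennreal (indicator {-1..1} u * h u / mass) * g u \<partial>lborel)"
  unfolding law_def by (rule nn_integral_density) measurable

lemma real_distribution_law: "real_distribution law"
proof -
  have "emeasure law UNIV = 1" using mass_pos by (simp add: emeasure_law)
  then have "prob_space law" by (intro prob_spaceI) (simp add: law_def)
  then show ?thesis
    by (simp add: real_distribution_def real_distribution_axioms_def law_def)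
qed

lemma measure_law:
  assumes "A \<in> sets borel"
  shows "measure law A = (LBINT s:A \<inter> {-1..1}. h s) / mass"
proof -
  have "0 \<le> (LBINT s:A \<inter> {-1..1}. h s)"
    unfolding set_lebesgue_integral_def using nonneg
    by (intro Bochner_Integration.integral_nonneg) (auto split: split_indicator)
  then show ?thesis using mass_pos by (simp add: measure_def emeasure_law[OF assms])
qed

lemma cdf_law: "cdf law q = normalized_cdf h (clip q)"
proof (cases "q < -1")
  case True
  then have "{..q} \<inter> {-1..1} = {}" "clip q = -1" by (auto simp: clip_def)
  moreover have "(LBINT s:{-1..-1}. h s) = 0"
    unfolding set_lebesgue_integral_def
    by (rule integral_eq_zero_AE, rule AE_I[where N = "{-1}"]) (auto split: split_indicator)
  ultimately show ?thesis by (simp add: cdf_def measure_law normalized_cdf_def set_lebesgue_integral_def)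
next
  case False
  then have "{..q} \<inter> {-1..1} = {-1..clip q}" by (auto simp: clip_def)
  then show ?thesis by (simp add: cdf_def measure_law normalized_cdf_def)
qed

lemma normalized_cdf_eq: "u \<in> {-1..1} \<Longrightarrow> normalized_cdf h u = cdf law u"
  by (simp add: cdf_law)

lemma normalized_cdf_minus_one: "normalized_cdf h (-1) = 0"
proof -
  have "cdf law (-2) = 0"
    by (simp add: cdf_def measure_law set_lebesgue_integral_def)
  then show ?thesis by (simp add: cdf_law clip_def)
qed

lemma normalized_cdf_one: "normalized_cdf h 1 = 1"
  using mass_pos by (simp add: normalized_cdf_def)

lemma continuous_normalized_cdf: "continuous_on {-1..1} (normalized_cdf h)"
proof -
  interpret real_distribution law by (rule real_distribution_law)
  have "isCont (cdf law) x" for x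
  proof -
    have "(LBINT s:{x} \<inter> {-1..1}. h s) = 0"
      unfolding set_lebesgue_integral_def
      by (rule integral_eq_zero_AE, rule AE_I[where N = "{x}"]) (auto split: split_indicator)
    then show ?thesis by (subst isCont_cdf) (simp add: measure_law)
  qed
  then have "continuous_on {-1..1} (cdf law)"
    by (simp add: continuous_at_imp_continuous_on)
  then show ?thesis by (rule continuous_on_eq) (simp add: normalized_cdf_eq)
qed

lemma strict_mono_normalized_cdf: "strict_mono_on {-1..1} (normalized_cdf h)"
proof (rule strict_mono_onI)
  fix a b :: real assume ab: "a \<in> {-1..1}" "b \<in> {-1..1}" "a < b"
  interpret real_distribution law by (rule real_distribution_law)
  have "cdf law b - cdf law a = measure law {a<..b}"
    using ab by (simp add: cdf_diff_eq)
  also have "\<dots> = (LBINT s:{a<..b} \<inter> {-1..1}. h s) / mass" by (rule measure_law) simp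
  also have "(LBINT s:{a<..b} \<inter> {-1..1}. h s) = (LBINT s:{a..b}. h s)"
    unfolding set_lebesgue_integral_def
  proof (rule integral_cong_AE)
    show "AE s in lborel. indicat_real ({a<..b} \<inter> {-1..1}) s *\<^sub>R h s = indicat_real {a..b} s *\<^sub>R h s"
      by (rule AE_I[where N = "{a}"]) (use ab in \<open>auto split: split_indicator_asm\<close>)
  qed (use sub_integrable[of "{a<..b} \<inter> {-1..1}"] sub_integrable[of "{a..b}"] ab in
      \<open>auto simp: set_integrable_def\<close>)
  also have "\<dots> / mass > 0" using positive_mass[of a b] ab mass_pos by simp
  finally show "normalized_cdf h a < normalized_cdf h b" using ab by (simp add: normalized_cdf_eq)
qed

lemma bij_normalized_cdf: "bij_betw (normalized_cdf h) {-1..1} {0..1}"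
proof (rule bij_betw_imageI)
  show "inj_on (normalized_cdf h) {-1..1}"
    using strict_mono_normalized_cdf by (rule strict_mono_on_imp_inj_on)
  show "normalized_cdf h ` {-1..1} = {0..1}"
  proof (intro equalityI subsetI)
    fix p assume "p \<in> normalized_cdf h ` {-1..1}"
    then obtain u where u: "u \<in> {-1..1}" "p = normalized_cdf h u" by auto
    have "normalized_cdf h (-1) \<le> p" "p \<le> normalized_cdf h 1"
      using u by (auto intro!: strict_mono_on_leD[OF strict_mono_normalized_cdf])
    then show "p \<in> {0..1}" by (simp add: normalized_cdf_minus_one normalized_cdf_one)
  next
    fix p :: real assume "p \<in> {0..1}"
    then show "p \<in> normalized_cdf h ` {-1..1}"
      using IVT'[of "normalized_cdf h" "-1" p 1] continuous_normalized_cdf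
      by (force simp: normalized_cdf_minus_one normalized_cdf_one)
  qed
qed

end

definition monotone_transport :: "(real \<Rightarrow> real) \<Rightarrow> (real \<Rightarrow> real) \<Rightarrow> real \<Rightarrow> real" where
  "monotone_transport h1 h2 u = the_inv_into {-1..1} (normalized_cdf h2) (normalized_cdf h1 u)"

locale axial_transport = source: axial_density h1 + target: axial_density h2
  for h1 h2 :: "real \<Rightarrow> real"
begin

abbreviation m :: "real \<Rightarrow> real" where "m \<equiv> monotone_transport h1 h2"

lemma m_bounds: "u \<in> {-1..1} \<Longrightarrow> m u \<in> {-1..1}"
  and cdf_m: "u \<in> {-1..1} \<Longrightarrow> normalized_cdf h2 (m u) = normalized_cdf h1 u"
proof -
  assume "u \<in> {-1..1}"
  then have p: "normalized_cdf h1 u \<in> {0..1}"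
    using source.bij_normalized_cdf by (auto simp: bij_betw_def)
  have inj: "inj_on (normalized_cdf h2) {-1..1}" and im: "normalized_cdf h2 ` {-1..1} = {0..1}"
    using target.bij_normalized_cdf by (auto simp: bij_betw_def)
  show "m u \<in> {-1..1}" using the_inv_into_into[OF inj _ subset_refl] p im
    unfolding monotone_transport_def by auto
  show "normalized_cdf h2 (m u) = normalized_cdf h1 u"
    unfolding monotone_transport_def using f_the_inv_into_f[OF inj] p im by auto
qed

lemma strict_mono_m: "strict_mono_on {-1..1} m"
proof (rule strict_mono_onI)
  fix a b :: real assume ab: "a \<in> {-1..1}" "b \<in> {-1..1}" "a < b"
  have "normalized_cdf h2 (m a) < normalized_cdf h2 (m b)"
    using strict_mono_onD[OF source.strict_mono_normalized_cdf ab] ab by (simp add: cdf_m)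
  then show "m a < m b"
    using strict_mono_on_less[OF target.strict_mono_normalized_cdf] m_bounds ab by blast
qed

lemma bij_m: "bij_betw m {-1..1} {-1..1}"
  using bij_betw_trans[OF source.bij_normalized_cdf bij_betw_the_inv_into[OF target.bij_normalized_cdf]]
  by (simp add: monotone_transport_def[abs_def] comp_def)

lemma continuous_m: "continuous_on {-1..1} m"
proof -
  have "continuous_on {0..1} (the_inv_into {-1..1} (normalized_cdf h2))"
    using continuous_on_inv[OF target.continuous_normalized_cdf, of "the_inv_into {-1..1} (normalized_cdf h2)"]
      target.bij_normalized_cdf
    by (auto simp: bij_betw_def the_inv_into_f_f)
  then show ?thesis
    unfolding monotone_transport_def[abs_def]
    by (rule continuous_on_compose2[OF _ source.continuous_normalized_cdf])
      (use source.bij_normalized_cdf in \<open>auto simp: bij_betw_def\<close>)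
qed

lemma m_one: "m 1 = 1" and m_minus_one: "m (-1) = -1"
proof -
  have "inj_on (normalized_cdf h2) {-1..1}" using target.bij_normalized_cdf by (simp add: bij_betw_def)
  then show "m 1 = 1" "m (-1) = -1"
    unfolding monotone_transport_def source.normalized_cdf_one source.normalized_cdf_minus_one
    using the_inv_into_f_f[of "normalized_cdf h2" "{-1..1}" 1]
      the_inv_into_f_f[of "normalized_cdf h2" "{-1..1}" "-1"]
    by (auto simp: target.normalized_cdf_one target.normalized_cdf_minus_one)
qed

lemma m_clip_measurable [measurable]: "(\<lambda>u. m (clip u)) \<in> borel_measurable borel"
  by (intro borel_measurable_continuous_onI continuous_on_compose2[OF continuous_m] continuous_intros)
    auto

text \<open>
  With \<open>p\<close> chosen such that the source distribution function at \<open>p\<close> equals the target one at \<open>q\<close>,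
  monotonicity turns the event \<open>m u \<le> q\<close> into \<open>u \<le> p\<close>; hence both sides have the same
  distribution function.
\<close>
lemma distr_m: "distr source.law borel (\<lambda>u. m (clip u)) = target.law"
proof (rule cdf_unique)
  interpret s: real_distribution source.law by (rule source.real_distribution_law)
  show "real_distribution (distr source.law borel (\<lambda>u. m (clip u)))"
    by (simp add: real_distribution_def real_distribution_axioms_def s.prob_space_distr)
  show "real_distribution target.law" by (rule target.real_distribution_law)
  show "cdf (distr source.law borel (\<lambda>u. m (clip u))) = cdf target.law"
  proof
    fix q :: real
    have "cdf (distr source.law borel (\<lambda>u. m (clip u))) q = measure source.law {u. m (clip u) \<le> q}"
      by (simp add: cdf_def measure_distr) (simp add: vimage_def)
    also have "\<dots> = measure source.law ({u. m (clip u) \<le> q} \<inter> {-1..1})"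
      by (simp add: source.measure_law)
    also have "\<dots> = normalized_cdf h2 (clip q)"
    proof (cases "q < -1")
      case True
      then have "{u. m (clip u) \<le> q} \<inter> {-1..1} = {}"
        using m_bounds by fastforce
      with True show ?thesis by (simp add: clip_def target.normalized_cdf_minus_one)
    next
      case False
      obtain p where p: "p \<in> {-1..1}" "normalized_cdf h1 p = normalized_cdf h2 (clip q)"
        using source.bij_normalized_cdf target.bij_normalized_cdf clip_bounds[of q]
        unfolding bij_betw_def by (metis imageE imageI)
      have "m u \<le> q \<longleftrightarrow> u \<le> p" if u: "u \<in> {-1..1}" for u
      proof -
        have "m u \<le> q \<longleftrightarrow> m u \<le> clip q"
          using m_bounds[OF u] False by (auto simp: clip_def)
        also have "\<dots> \<longleftrightarrow> normalized_cdf h2 (m u) \<le> normalized_cdf h2 (clip q)"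
          by (rule strict_mono_on_less_eq[OF target.strict_mono_normalized_cdf, symmetric])
            (use m_bounds[OF u] in auto)
        also have "\<dots> \<longleftrightarrow> normalized_cdf h1 u \<le> normalized_cdf h1 p" by (simp add: p cdf_m[OF u])
        also have "\<dots> \<longleftrightarrow> u \<le> p"
          by (rule strict_mono_on_less_eq[OF source.strict_mono_normalized_cdf]) (use u p in auto)
        finally show ?thesis .
      qed
      then have "{u. m (clip u) \<le> q} \<inter> {-1..1} = {..p} \<inter> {-1..1}" by auto
      then have "measure source.law ({u. m (clip u) \<le> q} \<inter> {-1..1}) = cdf source.law p"
        by (simp add: cdf_def source.measure_law)
      then show ?thesis using p by (simp add: source.cdf_law)
    qed
    also have "\<dots> = cdf target.law q" by (simp add: target.cdf_law)
    finally show "cdf (distr source.law borel (\<lambda>u. m (clip u))) q = cdf target.law q" .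
  qed
qed

end

section \<open>Dual certificates of optimality\<close>

text \<open>
  The primitive of a continuous strictly increasing function lies strictly above its tangents.
\<close>
lemma strictly_convex_potential:
  fixes m :: "real \<Rightarrow> real"
  assumes cont: "continuous_on {a..b} m" and mono: "strict_mono_on {a..b} m"
  obtains \<phi> where "continuous_on {a..b} \<phi>"
    "\<And>x y. x \<in> {a..b} \<Longrightarrow> y \<in> {a..b} \<Longrightarrow> x \<noteq> y \<Longrightarrow> \<phi> x + m x * (y - x) < \<phi> y"
proof
  let ?\<phi> = "\<lambda>x. integral {a..x} m"
  have der: "(?\<phi> has_real_derivative m x) (at x within {a..b})" if "x \<in> {a..b}" for x
    using integral_has_real_derivative[OF cont that] .
  show "continuous_on {a..b} ?\<phi>"
    using der by (meson DERIV_continuous_on)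
  fix x y assume xy: "x \<in> {a..b}" "y \<in> {a..b}" "x \<noteq> y"
  have mvt: "\<exists>t\<in>{p<..<q}. ?\<phi> q - ?\<phi> p = m t * (q - p)" if pq: "p < q" "p \<in> {a..b}" "q \<in> {a..b}" for p q
  proof -
    have "\<exists>t. t \<in> {p<..<q} \<and> ?\<phi> q - ?\<phi> p = (q - p) *\<^sub>R m t"
    proof (rule mvt_simple[OF pq(1), where f = ?\<phi> and f' = "\<lambda>t s. s * m t", simplified, THEN bexE])
      fix t assume "p \<le> t" "t \<le> q"
      then have "(?\<phi> has_real_derivative m t) (at t within {p..q})"
        using pq by (intro DERIV_subset[OF der]) auto
      then show "(?\<phi> has_derivative (\<lambda>s. s * m t)) (at t within {p..q})"
        by (simp add: has_field_derivative_def mult_commute_abs)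
    qed auto
    then show ?thesis by (auto simp: mult.commute)
  qed
  show "?\<phi> x + m x * (y - x) < ?\<phi> y"
  proof (cases "x < y")
    case True
    then obtain t where t: "t \<in> {x<..<y}" "?\<phi> y - ?\<phi> x = m t * (y - x)" using mvt xy by blast
    have "m x < m t" using t xy by (intro strict_mono_onD[OF mono]) auto
    then have "m x * (y - x) < m t * (y - x)" using True by (intro mult_strict_right_mono) auto
    with t(2) show ?thesis by linarith
  next
    case False
    then have lt: "y < x" using xy by simp
    then obtain t where t: "t \<in> {y<..<x}" "?\<phi> x - ?\<phi> y = m t * (x - y)" using mvt xy by blast
    have "m t < m x" using t xy by (intro strict_mono_onD[OF mono]) auto
    then have "m t * (x - y) < m x * (x - y)" using lt by (intro mult_strict_right_mono) auto
    moreover have "m x * (y - x) = - (m x * (x - y))" by (simp add: algebra_simps)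
    ultimately show ?thesis using t(2) by linarith
  qed
qed

text \<open>
  The potentials are \<open>x\<^sup>2 / 2 - \<phi> x\<close> and \<open>y\<^sup>2 / 2 - \<phi>* y\<close>, where \<open>\<phi>\<close> is a primitive of \<open>m\<close> and
  \<open>\<phi>* y = g y * y - \<phi> (g y)\<close>, with \<open>g\<close> the inverse of \<open>m\<close>, is its Legendre transform. The slack is
  the gap in Young's inequality \<open>x * y \<le> \<phi> x + \<phi>* y\<close>: the height of the graph of \<open>\<phi>\<close> at \<open>x\<close> above
  its tangent at \<open>g y\<close>.
\<close>
lemma quadratic_cost_potentials:
  fixes m :: "real \<Rightarrow> real"
  assumes cont: "continuous_on {a..b} m" and mono: "strict_mono_on {a..b} m"
    and im: "m ` {a..b} = T"
  obtains A B where "continuous_on {a..b} A" "continuous_on T B"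
    "\<And>x y. x \<in> {a..b} \<Longrightarrow> y \<in> T \<Longrightarrow> A x + B y \<le> (x - y)\<^sup>2 / 2"
    "\<And>x y. x \<in> {a..b} \<Longrightarrow> y \<in> T \<Longrightarrow> A x + B y = (x - y)\<^sup>2 / 2 \<longleftrightarrow> y = m x"
proof -
  obtain \<phi> where cphi: "continuous_on {a..b} \<phi>" and
    phi: "\<And>x y. x \<in> {a..b} \<Longrightarrow> y \<in> {a..b} \<Longrightarrow> x \<noteq> y \<Longrightarrow> \<phi> x + m x * (y - x) < \<phi> y"
    using strictly_convex_potential[OF cont mono] by blast
  have inj: "inj_on m {a..b}" using mono by (rule strict_mono_on_imp_inj_on)
  define g where "g = the_inv_into {a..b} m"
  have gm: "g (m x) = x" if "x \<in> {a..b}" for x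
    using that inj by (simp add: g_def the_inv_into_f_f)
  have cg: "continuous_on T g"
    using continuous_on_inv[OF cont, of g] gm im by simp
  have gT: "g y \<in> {a..b}" "m (g y) = y" if "y \<in> T" for y
    using that im gm by auto
  define A where "A = (\<lambda>x. x\<^sup>2 / 2 - \<phi> x)"
  define B where "B = (\<lambda>y. y\<^sup>2 / 2 - (g y * y - \<phi> (g y)))"
  have gap: "(x - y)\<^sup>2 / 2 - (A x + B y) = \<phi> x - (\<phi> (g y) + m (g y) * (x - g y))"
    if "y \<in> T" for x y
    using gT[OF that] by (simp add: A_def B_def power2_eq_square field_simps)
  show ?thesis
  proof (rule that)
    show "continuous_on {a..b} A" unfolding A_def by (intro continuous_intros cphi) auto
    show "continuous_on T B" unfolding B_def
      by (intro continuous_intros cg continuous_on_compose2[OF cphi cg]) (use gT in auto)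
    fix x y assume xy: "x \<in> {a..b}" "y \<in> T"
    show "A x + B y \<le> (x - y)\<^sup>2 / 2"
      using gap[OF xy(2), of x] phi[of "g y" x] gT[OF xy(2)] xy by (cases "g y = x") auto
    show "A x + B y = (x - y)\<^sup>2 / 2 \<longleftrightarrow> y = m x"
      using gap[OF xy(2), of x] phi[of "g y" x] gT[OF xy(2)] xy gm by (cases "g y = x") auto
  qed
qed

text \<open>
  Weak duality and complementary slackness for transport to the uniform distribution.
  The integral of \<open>Y y + V (T y)\<close> is the same for all transport maps \<open>T\<close>, since \<open>T y\<close> always has the
  uniform law; it is a lower bound for the cost, attained by \<open>G\<close>. A map attaining it as well
  leaves a nonnegative gap with vanishing integral.
\<close>
lemma optimal_transport_map_certificate:
  fixes P :: "(real^'n) measure"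
  assumes P: "prob_space P"
    and G: "G \<in> transport_maps P"
    and Y: "Y \<in> borel_measurable P" "\<And>z. z \<in> space P \<Longrightarrow> \<bar>Y z\<bar> \<le> C1"
    and V: "V \<in> borel_measurable (restrict_space borel unit_sphere)" "\<And>z. z \<in> unit_sphere \<Longrightarrow> \<bar>V z\<bar> \<le> C2"
    and le: "\<And>y z. y \<in> space P \<Longrightarrow> z \<in> unit_sphere \<Longrightarrow> Y y + V z \<le> transport_cost y z"
    and eq: "\<And>y. y \<in> space P \<Longrightarrow> Y y + V (G y) = transport_cost y (G y)"
    and sph: "space P = unit_sphere" "sets P = sets (restrict_space borel unit_sphere)"
  shows "optimal_transport_map P G"
    and "optimal_transport_map P S \<Longrightarrow> AE y in P. Y y + V (S y) = transport_cost y (S y)"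
proof -
  interpret prob_space P by fact
  have integral_split: "integrable P Y" "integrable P (\<lambda>y. V (T y))"
    "integrable P (\<lambda>y. transport_cost y (T y))"
    "(\<integral>y. Y y + V (T y) \<partial>P) = (\<integral>y. Y y \<partial>P) + (\<integral>z. V z \<partial>uniform_sphere)"
    if T: "T \<in> transport_maps P" for T
  proof -
    have mT[measurable]: "T \<in> P \<rightarrow>\<^sub>M restrict_space borel unit_sphere"
      and dT: "distr P (restrict_space borel unit_sphere) T = uniform_sphere"
      using T by (auto simp: transport_maps_def)
    have Ts: "T y \<in> unit_sphere" if "y \<in> space P" for y
      using measurable_space[OF mT that] by (simp add: space_restrict_space)
    show i1: "integrable P Y"
      using Y by (intro integrable_const_bound[where B = C1]) (auto intro: AE_I2)
    have "(\<lambda>y. V (T y)) \<in> borel_measurable P" using measurable_compose[OF mT V(1)] .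
    then show i2: "integrable P (\<lambda>y. V (T y))"
      using V(2) Ts by (intro integrable_const_bound[where B = C2]) (auto intro: AE_I2)
    have "(\<lambda>y. T y) \<in> borel_measurable P"
      using mT by (simp add: measurable_restrict_space2_iff)
    moreover have "(\<lambda>y. y) \<in> borel_measurable P"
      using measurable_ident_sets[OF sph(2)] by (simp add: measurable_restrict_space2_iff)
    ultimately have "(\<lambda>y. y \<bullet> T y) \<in> borel_measurable P" by measurable
    moreover have "y \<bullet> T y \<in> {-1..1}" if "y \<in> space P" for y
      using Cauchy_Schwarz_ineq2[of y "T y"] that Ts[OF that] sph by (simp add: abs_le_iff)
    ultimately have "(\<lambda>y. y \<bullet> T y) \<in> P \<rightarrow>\<^sub>M restrict_space borel {-1..1}"
      by (intro measurable_restrict_space2) auto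
    moreover have "arccos \<in> borel_measurable (restrict_space borel {-1..1})"
      by (intro borel_measurable_continuous_on_restrict continuous_on_arccos') 
    ultimately have "(\<lambda>y. arccos (y \<bullet> T y)) \<in> borel_measurable P"
      by (rule measurable_compose)
    then have "(\<lambda>y. transport_cost y (T y)) \<in> borel_measurable P"
      unfolding transport_cost_def geodesic_dist_def by measurable
    moreover have "\<bar>transport_cost y (T y)\<bar> \<le> pi\<^sup>2 / 2" if "y \<in> space P" for y
    proof -
      have "\<bar>y \<bullet> T y\<bar> \<le> 1"
        using Cauchy_Schwarz_ineq2[of y "T y"] that Ts[OF that] sph by simp
      then have "0 \<le> arccos (y \<bullet> T y)" "arccos (y \<bullet> T y) \<le> pi"
        by (auto intro: arccos_lbound arccos_ubound simp: abs_le_iff)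
      then show ?thesis by (simp add: transport_cost_def geodesic_dist_def power_mono)
    qed
    ultimately show "integrable P (\<lambda>y. transport_cost y (T y))"
      by (intro integrable_const_bound[where B = "pi\<^sup>2 / 2"]) (auto intro: AE_I2)
    have "(\<integral>z. V z \<partial>uniform_sphere) = (\<integral>y. V (T y) \<partial>P)"
      unfolding dT[symmetric] by (rule integral_distr[OF mT V(1)])
    then show "(\<integral>y. Y y + V (T y) \<partial>P) = (\<integral>y. Y y \<partial>P) + (\<integral>z. V z \<partial>uniform_sphere)"
      using i1 i2 by simp
  qed
  have Ts: "T y \<in> unit_sphere" if "T \<in> transport_maps P" "y \<in> space P" for T y
    using measurable_space[of T P "restrict_space borel unit_sphere" y] that
    by (simp add: transport_maps_def space_restrict_space)
  have Gcost: "(\<integral>y. transport_cost y (G y) \<partial>P) = (\<integral>y. Y y \<partial>P) + (\<integral>z. V z \<partial>uniform_sphere)"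
    unfolding integral_split(4)[OF G, symmetric] by (intro Bochner_Integration.integral_cong) (auto simp: eq)
  have lower: "(\<integral>y. Y y \<partial>P) + (\<integral>z. V z \<partial>uniform_sphere) \<le> (\<integral>y. transport_cost y (T y) \<partial>P)"
    if T: "T \<in> transport_maps P" for T
    unfolding integral_split(4)[OF T, symmetric]
    using integral_split[OF T] le Ts[OF T] by (intro integral_mono) auto
  show "optimal_transport_map P G"
    unfolding optimal_transport_map_def using G Gcost lower by simp
  assume "optimal_transport_map P S"
  then have S: "S \<in> transport_maps P"
    and Sle: "(\<integral>y. transport_cost y (S y) \<partial>P) \<le> (\<integral>y. transport_cost y (G y) \<partial>P)"
    using G by (auto simp: optimal_transport_map_def)
  let ?gap = "\<lambda>y. transport_cost y (S y) - (Y y + V (S y))"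
  have "(\<integral>y. ?gap y \<partial>P) = (\<integral>y. transport_cost y (S y) \<partial>P) - (\<integral>y. Y y + V (S y) \<partial>P)"
    using integral_split[OF S] by (intro Bochner_Integration.integral_diff) auto
  then have "(\<integral>y. ?gap y \<partial>P) = 0"
    using lower[OF S] Sle Gcost integral_split(4)[OF S] by linarith
  moreover have "integrable P ?gap" using integral_split[OF S] by auto
  moreover have "AE y in P. 0 \<le> ?gap y" using le Ts[OF S] by (auto intro!: AE_I2)
  ultimately have "AE y in P. ?gap y = 0"
    using integral_nonneg_eq_0_iff_AE by blast
  then show "AE y in P. Y y + V (S y) = transport_cost y (S y)" by eventually_elim simp
qed

lemma optimal_transport_map_cong:
  assumes "\<And>z. z \<in> space P \<Longrightarrow> S z = T z"
  shows "optimal_transport_map P S \<longleftrightarrow> optimal_transport_map P T"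
proof -
  have "S \<in> transport_maps P \<longleftrightarrow> T \<in> transport_maps P"
    unfolding transport_maps_def
    using measurable_cong[of P S T] distr_cong[of P P _ _ S T] assms by auto
  moreover have "(\<integral>z. transport_cost z (S z) \<partial>P) = (\<integral>z. transport_cost z (T z) \<partial>P)"
    using assms by (intro Bochner_Integration.integral_cong) auto
  ultimately show ?thesis by (simp add: optimal_transport_map_def)
qed

section \<open>The directional distribution function\<close>

text \<open>
  Total mass one carries analytic information: the norming integral is finite and nonzero,
  as \<open>norming_const\<close> would otherwise be \<open>0\<close> and the measure null. The parameter
  \<open>d\<close> names the dimension so that the abbreviations below do not depend on a type argument.
\<close>
locale rotationally_symmetric =
  fixes \<theta> :: "real^'n" and d :: nat and f :: "real \<Rightarrow> real"
  assumes d: "d = CARD('n)" and dim: "2 \<le> CARD('n)"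
    and axis: "norm \<theta> = 1"
    and angular: "angular_function f"
    and prob: "prob_space (rotsym_distribution \<theta> f)"
begin

abbreviation "P \<equiv> rotsym_distribution \<theta> f"
abbreviation "w \<equiv> axial_weight d"
abbreviation "fw \<equiv> \<lambda>s. f s * w s"

lemma space_P [simp]: "space P = unit_sphere"
  by (simp add: rotsym_distribution_def)
lemma sets_P [simp, measurable_cong]: "sets P = sets (restrict_space borel unit_sphere)"
  by (simp add: rotsym_distribution_def)

lemma f_clip_pos: "0 < f (clip u)"
  using angular by (simp add: angular_function_def)

lemma f_clip_measurable [measurable]: "(\<lambda>u. f (clip u)) \<in> borel_measurable borel"
proof -
  have "clip \<in> borel \<rightarrow>\<^sub>M restrict_space borel {-1..1}"
    by (intro measurable_restrict_space2 borel_measurable_continuous_onI continuous_on_clip) auto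
  then show ?thesis using angular unfolding angular_function_def by (auto dest: measurable_compose)
qed

lemma latitude_clip: "z \<in> unit_sphere \<Longrightarrow> clip (z \<bullet> \<theta>) = z \<bullet> \<theta>"
  using inner_unit_bounds[of z \<theta>] axis by simp

lemma surface_measurable:
  assumes "g \<in> borel_measurable borel" shows "g \<in> borel_measurable surface_measure"
  unfolding measurable_cong_sets[OF sets_surface_measure refl]
  using assms by (rule measurable_restrict_space1)

lemma P_eq_density_clip: "P = density surface_measure (\<lambda>z. ennreal (norming_const \<theta> f * f (clip (z \<bullet> \<theta>))))"
  and clip_density_measurable: "(\<lambda>z. ennreal (norming_const \<theta> f * f (clip (z \<bullet> \<theta>)))) \<in> borel_measurable surface_measure"
proof -
  let ?g = "\<lambda>z. ennreal (norming_const \<theta> f * f (clip (z \<bullet> \<theta>)))"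
  show g: "?g \<in> borel_measurable surface_measure" by (rule surface_measurable) measurable
  then have "(\<lambda>z. ennreal (norming_const \<theta> f * f (z \<bullet> \<theta>))) \<in> borel_measurable surface_measure"
    by (rule measurable_cong[THEN iffD1, rotated]) (simp add: latitude_clip)
  then show "P = density surface_measure ?g"
    unfolding rotsym_distribution_def using g
    by (rule density_cong) (auto intro!: AE_I2 simp: latitude_clip)
qed

lemma nn_integral_P:
  fixes h :: "real^'n \<Rightarrow> ennreal"
  assumes [measurable]: "h \<in> borel_measurable borel"
  shows "(\<integral>\<^sup>+z. h z \<partial>P) =
    (\<integral>\<^sup>+z. ennreal (norming_const \<theta> f * f (clip (z \<bullet> \<theta>))) * h z \<partial>surface_measure)"
  unfolding P_eq_density_clip
  by (intro nn_integral_density clip_density_measurable surface_measurable assms)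

lemma norming_const_pos: "0 < norming_const \<theta> f"
  and integrable_surface: "integrable surface_measure (\<lambda>z. f (clip (z \<bullet> \<theta>)))"
proof -
  have eq: "(\<integral>z. f (z \<bullet> \<theta>) \<partial>surface_measure) = (\<integral>z. f (clip (z \<bullet> \<theta>)) \<partial>surface_measure)"
    by (intro Bochner_Integration.integral_cong) (auto simp: latitude_clip)
  \<comment> \<open>The Bochner integral of a non-integrable function is \<open>0\<close>, and \<open>1 / 0 = 0\<close>.\<close>
  have "norming_const \<theta> f \<noteq> 0"
  proof
    assume "norming_const \<theta> f = 0"
    then have "(\<integral>\<^sup>+z. 1 \<partial>P) = 0" by (subst nn_integral_P) auto
    then show False using prob_space.emeasure_space_1[OF prob] by simp
  qed
  then have n0: "(\<integral>z. f (clip (z \<bullet> \<theta>)) \<partial>surface_measure) \<noteq> 0"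
    unfolding norming_const_def eq by simp
  then show "integrable surface_measure (\<lambda>z. f (clip (z \<bullet> \<theta>)))"
    using not_integrable_integral_eq by blast
  have "0 \<le> (\<integral>z. f (clip (z \<bullet> \<theta>)) \<partial>surface_measure)"
    by (intro Bochner_Integration.integral_nonneg) (simp add: f_clip_pos less_imp_le)
  with n0 show "0 < norming_const \<theta> f" unfolding norming_const_def eq by simp
qed

abbreviation "\<kappa> \<equiv> meridian_measure \<theta>"

lemma nn_integral_axial:
  assumes [measurable]: "g \<in> borel_measurable borel"
  shows "(\<integral>\<^sup>+z. g (z \<bullet> \<theta>) \<partial>surface_measure) =
    (\<integral>\<^sup>+u. ennreal (w u) * indicator {-1<..<1} u * g u \<partial>lborel) * emeasure \<kappa> UNIV"
proof -
  have "(\<integral>\<^sup>+e. g (polar_point \<theta> u e \<bullet> \<theta>) \<partial>\<kappa>) = g u * emeasure \<kappa> UNIV" if u: "u \<in> {-1<..<1}" for u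
  proof -
    have "(\<integral>\<^sup>+e. g (polar_point \<theta> u e \<bullet> \<theta>) \<partial>\<kappa>) = (\<integral>\<^sup>+e. g u \<partial>\<kappa>)"
      using AE_meridian_measure[OF axis]
      by (intro nn_integral_cong_AE, eventually_elim) (use u axis in \<open>simp add: inner_polar_point\<close>)
    then show ?thesis by simp
  qed
  then have "(\<integral>\<^sup>+z. g (z \<bullet> \<theta>) \<partial>surface_measure) =
    (\<integral>\<^sup>+u. ennreal (w u) * indicator {-1<..<1} u * g u * emeasure \<kappa> UNIV \<partial>lborel)"
    by (subst nn_integral_surface_measure_polar[OF _ axis dim, folded d], measurable)
      (auto intro!: nn_integral_cong split: split_indicator simp: mult.assoc)
  then show ?thesis by (simp add: nn_integral_multc)
qed

text \<open>
  Integrability of the angular weight needs no computation, not even for the singular weight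
  in dimension two: the product of the two total masses is the finite and nonzero area of the sphere.
\<close>
lemma kappa_finite: "emeasure \<kappa> UNIV \<noteq> 0" "emeasure \<kappa> UNIV \<noteq> \<infinity>"
  and weight_finite: "(\<integral>\<^sup>+u. ennreal (w u) * indicator {-1<..<1} u \<partial>lborel) \<noteq> \<infinity>"
proof -
  let ?W = "(\<integral>\<^sup>+u. ennreal (w u) * indicator {-1<..<1} u \<partial>lborel)"
  have "emeasure surface_measure (unit_sphere :: (real^'n) set) = ?W * emeasure \<kappa> UNIV"
    using nn_integral_axial[of "\<lambda>_. 1"] by simp
  then have "?W * emeasure \<kappa> UNIV \<noteq> 0" "?W * emeasure \<kappa> UNIV < \<top>"
    using emeasure_surface_measure_sphere[where 'n='n] by auto
  then show "emeasure \<kappa> UNIV \<noteq> 0" "emeasure \<kappa> UNIV \<noteq> \<infinity>" "?W \<noteq> \<infinity>"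
    by (auto simp: ennreal_mult_less_top)
qed

text \<open>
  At the end points \<open>0 powr a = 0\<close> for every exponent, so closed and open intervals may be
  exchanged pointwise.
\<close>
lemma indicator_weight: "indicator {-1..1} u * w u = indicator {-1<..<1} u * w u"
  by (auto simp: axial_weight_def split: split_indicator)

lemma weight_pos: "u \<in> {-1<..<1} \<Longrightarrow> 0 < w u"
proof -
  assume "u \<in> {-1<..<1}"
  then have "u\<^sup>2 < 1" by (simp add: abs_square_less_1 abs_less_iff)
  then show ?thesis by (simp add: axial_weight_def)
qed

lemma weight_nonneg: "0 \<le> w u" by (simp add: axial_weight_def)

lemma integrable_weighted:
  assumes [measurable]: "(\<lambda>u. g (clip u)) \<in> borel_measurable borel" and nn: "\<And>u. 0 \<le> g (clip u)"
    and fin: "(\<integral>\<^sup>+u. ennreal (w u) * indicator {-1<..<1} u * ennreal (g (clip u)) \<partial>lborel) \<noteq> \<infinity>"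
  shows "set_integrable lborel {-1..1} (\<lambda>s. g s * w s)"
proof -
  have eq: "(\<lambda>s. indicator {-1..1} s *\<^sub>R (g s * w s)) = (\<lambda>s. w s * indicator {-1<..<1} s * g (clip s))"
  proof
    fix s show "indicator {-1..1} s *\<^sub>R (g s * w s) = w s * indicator {-1<..<1} s * g (clip s)"
      using indicator_weight[of s] by (auto split: split_indicator simp: mult.commute)
  qed
  have "(\<integral>\<^sup>+s. ennreal (norm (w s * indicator {-1<..<1} s * g (clip s))) \<partial>lborel) =
     (\<integral>\<^sup>+u. ennreal (w u) * indicator {-1<..<1} u * ennreal (g (clip u)) \<partial>lborel)"
    using nn weight_nonneg
    by (intro nn_integral_cong) (auto split: split_indicator simp: ennreal_mult)
  then show ?thesis
    unfolding set_integrable_def eq using fin by (intro integrableI_bounded) (auto simp: less_top)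
qed

text \<open>
  The polar formula turns the finite norming integral over the sphere into integrability of the
  weighted angular function on the interval.
\<close>
sublocale axial_transport fw w
proof -
  have "(\<integral>\<^sup>+z. ennreal (f (clip (z \<bullet> \<theta>))) \<partial>surface_measure) \<noteq> \<infinity>"
    using integrable_surface f_clip_pos
    by (subst nn_integral_eq_integral) (auto intro: less_imp_le)
  then have "(\<integral>\<^sup>+u. ennreal (w u) * indicator {-1<..<1} u * ennreal (f (clip u)) \<partial>lborel) \<noteq> \<infinity>"
    using kappa_finite(1) by (subst (asm) nn_integral_axial[of "\<lambda>u. ennreal (f (clip u))"]) (auto simp: ennreal_mult_eq_top_iff)
  then have "set_integrable lborel {-1..1} fw"
    using f_clip_pos by (intro integrable_weighted) (auto intro: less_imp_le)
  moreover have "set_integrable lborel {-1..1} w"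
    using integrable_weighted[of "\<lambda>_. 1"] weight_finite by simp
  moreover have "0 < f u" if "u \<in> {-1..1}" for u using f_clip_pos[of u] that by simp
  ultimately show "axial_transport fw w"
    using weight_pos weight_nonneg
    by (intro axial_transport.intro axial_density.intro) (auto intro!: mult_pos_pos mult_nonneg_nonneg less_imp_le[of 0 "f _"])
qed

abbreviation "F \<equiv> meridian_map \<theta> m"

lemma F_sphere: "z \<in> unit_sphere \<Longrightarrow> F z \<in> unit_sphere"
  and F_latitude: "z \<in> unit_sphere \<Longrightarrow> F z \<bullet> \<theta> = m (z \<bullet> \<theta>)"
  using norm_meridian_map[OF axis, of z m] inner_meridian_map[OF axis, of z m]
    m_bounds[of "z \<bullet> \<theta>"] inner_unit_bounds[of z \<theta>] axis m_one m_minus_one by auto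

lemma F_continuous: "continuous_on unit_sphere F"
  by (rule continuous_on_meridian_map[OF axis continuous_m m_bounds m_one m_minus_one])

lemma F_measurable: "F \<in> P \<rightarrow>\<^sub>M restrict_space borel unit_sphere"
  unfolding measurable_cong_sets[OF sets_P refl]
  by (intro measurable_restrict_space2 borel_measurable_continuous_on_restrict F_continuous)
    (auto simp: space_restrict_space dest: F_sphere)

text \<open>
  In polar coordinates the meridian map fixes the equatorial variable and applies \<open>m\<close> to the
  latitude. Hence integrating out the equatorial variable first, which yields \<open>L\<close>, leaves
  a one-dimensional integral to which \<open>distr_m\<close> applies. Only proportionality is needed:
  the constant is determined by comparing total masses.
\<close>
lemma emeasure_pushforward:
  assumes [measurable]: "A \<in> sets borel" and "A \<subseteq> unit_sphere"
  shows "emeasure (distr P (restrict_space borel unit_sphere) F) A =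
    ennreal (norming_const \<theta> f * source.mass / target.mass) * emeasure surface_measure A"
proof -
  let ?F = "meridian_map \<theta> (\<lambda>u. m (clip u))" and ?c = "norming_const \<theta> f"
  have [measurable]: "?F \<in> borel_measurable borel" by (rule meridian_map_measurable) measurable
  define L where "L = (\<lambda>u. \<integral>\<^sup>+e. indicator A (polar_point \<theta> u e) \<partial>\<kappa>)"
  interpret K: finite_measure \<kappa> using kappa_finite by (intro finite_measureI) simp
  have [measurable]: "L \<in> borel_measurable borel" unfolding L_def by measurable
  have A': "A \<in> sets (restrict_space borel unit_sphere)"
    using assms by (auto simp: sets_restrict_space)
  have c: "0 < ?c" by (rule norming_const_pos)
  have "emeasure (distr P (restrict_space borel unit_sphere) F) A
      = (\<integral>\<^sup>+z. indicator A z \<partial>distr P (restrict_space borel unit_sphere) F)"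
    using A' by simp
  also have "\<dots> = (\<integral>\<^sup>+z. indicator A (F z) \<partial>P)"
    using A' by (intro nn_integral_distr F_measurable) auto
  also have "\<dots> = (\<integral>\<^sup>+z. indicator A (?F z) \<partial>P)"
    by (intro nn_integral_cong) (simp add: meridian_map_def latitude_clip)
  also have "\<dots> = (\<integral>\<^sup>+z. ennreal (?c * f (clip (z \<bullet> \<theta>))) * indicator A (?F z) \<partial>surface_measure)"
    by (rule nn_integral_P) measurable
  also have "\<dots> = (\<integral>\<^sup>+u. ennreal (w u) * indicator {-1<..<1} u *
      (\<integral>\<^sup>+e. ennreal (?c * f (clip (polar_point \<theta> u e \<bullet> \<theta>))) * indicator A (?F (polar_point \<theta> u e)) \<partial>\<kappa>) \<partial>lborel)"
    by (rule nn_integral_surface_measure_polar[OF _ axis dim, folded d]) measurable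
  also have "\<dots> = (\<integral>\<^sup>+u. ennreal (w u) * indicator {-1<..<1} u * (ennreal (?c * f (clip u)) * L (m (clip u))) \<partial>lborel)"
  proof (rule nn_integral_cong)
    fix u :: real
    have "(\<integral>\<^sup>+e. ennreal (?c * f (clip (polar_point \<theta> u e \<bullet> \<theta>))) * indicator A (?F (polar_point \<theta> u e)) \<partial>\<kappa>)
       = ennreal (?c * f (clip u)) * L (m (clip u))" if u: "u \<in> {-1<..<1}"
    proof -
      have "(\<integral>\<^sup>+e. ennreal (?c * f (clip (polar_point \<theta> u e \<bullet> \<theta>))) * indicator A (?F (polar_point \<theta> u e)) \<partial>\<kappa>)
       = (\<integral>\<^sup>+e. ennreal (?c * f (clip u)) * indicator A (polar_point \<theta> (m (clip u)) e) \<partial>\<kappa>)"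
        using AE_meridian_measure[OF axis]
        by (intro nn_integral_cong_AE, eventually_elim)
          (use u axis in \<open>simp add: inner_polar_point directional_sign_polar_point meridian_map_def\<close>)
      also have "\<dots> = ennreal (?c * f (clip u)) * L (m (clip u))"
        unfolding L_def by (rule nn_integral_cmult) measurable
      finally show ?thesis .
    qed
    then show "ennreal (w u) * indicator {-1<..<1} u *
      (\<integral>\<^sup>+e. ennreal (?c * f (clip (polar_point \<theta> u e \<bullet> \<theta>))) * indicator A (?F (polar_point \<theta> u e)) \<partial>\<kappa>)
      = ennreal (w u) * indicator {-1<..<1} u * (ennreal (?c * f (clip u)) * L (m (clip u)))"
      by (cases "u \<in> {-1<..<1}") auto
  qed
  also have "\<dots> = (\<integral>\<^sup>+u. ennreal (?c * source.mass) *
      (ennreal (indicator {-1..1} u * fw u / source.mass) * L (m (clip u))) \<partial>lborel)"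
  proof (rule nn_integral_cong)
    fix u :: real
    have "ennreal (w u) * indicator {-1<..<1} u * ennreal (?c * f (clip u)) =
       ennreal (w u * indicator {-1<..<1} u * (?c * f (clip u)))"
      using weight_nonneg[of u] f_clip_pos[of u] c by (auto split: split_indicator simp: ennreal_mult)
    also have "w u * indicator {-1<..<1} u * (?c * f (clip u)) = ?c * (indicator {-1..1} u * w u) * f (clip u)"
      unfolding indicator_weight by (simp add: mult.commute)
    also have "\<dots> = (?c * source.mass) * (indicator {-1..1} u * fw u / source.mass)"
      using source.mass_pos by (auto split: split_indicator)
    also have "ennreal \<dots> = ennreal (?c * source.mass) * ennreal (indicator {-1..1} u * fw u / source.mass)"
      using c source.mass_pos by (intro ennreal_mult') auto
    finally show "ennreal (w u) * indicator {-1<..<1} u * (ennreal (?c * f (clip u)) * L (m (clip u))) =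
       ennreal (?c * source.mass) * (ennreal (indicator {-1..1} u * fw u / source.mass) * L (m (clip u)))"
      by (simp only: mult.assoc[symmetric])
  qed
  also have "\<dots> = ennreal (?c * source.mass) * (\<integral>\<^sup>+u. L (m (clip u)) \<partial>source.law)"
    by (subst nn_integral_cmult, measurable) (simp add: source.nn_integral_law)
  also have "(\<integral>\<^sup>+u. L (m (clip u)) \<partial>source.law) = (\<integral>\<^sup>+v. L v \<partial>distr source.law borel (\<lambda>u. m (clip u)))"
    by (rule nn_integral_distr[symmetric]) (auto simp: source.law_def)
  also have "\<dots> = (\<integral>\<^sup>+v. ennreal (indicator {-1..1} v * w v / target.mass) * L v \<partial>lborel)"
    unfolding distr_m by (rule target.nn_integral_law) measurable
  also have "\<dots> = (\<integral>\<^sup>+v. ennreal (1 / target.mass) * (ennreal (w v) * indicator {-1<..<1} v * L v) \<partial>lborel)"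
  proof (rule nn_integral_cong)
    fix v :: real
    have "ennreal (indicator {-1..1} v * w v / target.mass) = ennreal (1 / target.mass * (indicator {-1<..<1} v * w v))"
      unfolding indicator_weight by simp
    also have "\<dots> = ennreal (1 / target.mass) * (ennreal (w v) * indicator {-1<..<1} v)"
      using target.mass_pos weight_nonneg[of v] by (subst ennreal_mult') (auto split: split_indicator)
    finally show "ennreal (indicator {-1..1} v * w v / target.mass) * L v =
       ennreal (1 / target.mass) * (ennreal (w v) * indicator {-1<..<1} v * L v)"
      by (simp only: mult.assoc)
  qed
  also have "\<dots> = ennreal (1 / target.mass) * (\<integral>\<^sup>+v. ennreal (w v) * indicator {-1<..<1} v * L v \<partial>lborel)"
    by (rule nn_integral_cmult) measurable
  also have "(\<integral>\<^sup>+v. ennreal (w v) * indicator {-1<..<1} v * L v \<partial>lborel) = (\<integral>\<^sup>+z. indicator A z \<partial>surface_measure)"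
    unfolding L_def by (rule nn_integral_surface_measure_polar[OF _ axis dim, folded d, symmetric]) measurable
  also have "\<dots> = emeasure surface_measure A" using A' by simp
  finally show ?thesis
    using c source.mass_pos target.mass_pos
    by (simp add: mult.assoc[symmetric] ennreal_mult'[symmetric])
qed

lemma F_transport: "F \<in> transport_maps P"
proof -
  let ?S = "unit_sphere :: (real^'n) set" and ?D = "distr P (restrict_space borel unit_sphere) F"
  let ?k = "ennreal (norming_const \<theta> f * source.mass / target.mass)"
  have "emeasure ?D ?S = 1"
    using prob_space.emeasure_space_1[OF prob_space.prob_space_distr[OF prob F_measurable]]
    by (simp add: space_restrict_space)
  then have one: "?k * emeasure surface_measure ?S = 1" by (subst (asm) emeasure_pushforward) auto
  have k: "?k = 1 / emeasure surface_measure ?S"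
    using emeasure_surface_measure_sphere[where 'n='n] one
    by (metis ennreal_mult_divide_eq infinity_ennreal_def less_irrefl)
  have "?D = uniform_sphere"
  proof (rule measure_eqI)
    show "sets ?D = sets uniform_sphere" by (simp add: uniform_sphere_def)
    fix A assume "A \<in> sets ?D"
    then have A: "A \<in> sets borel" "A \<subseteq> ?S" "A \<in> sets surface_measure" by (auto simp: sets_restrict_space)
    have S: "?S \<in> sets surface_measure" by (auto simp: sets_restrict_space)
    have "emeasure ?D A = ?k * emeasure surface_measure A" by (rule emeasure_pushforward[OF A(1,2)])
    also have "\<dots> = emeasure surface_measure (?S \<inter> A) / emeasure surface_measure ?S"
      using A unfolding k by (simp add: Int_absorb1 ennreal_times_divide mult.commute)
    also have "\<dots> = emeasure uniform_sphere A"
      unfolding uniform_sphere_def using A S by (simp add: emeasure_uniform_measure)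
    finally show "emeasure ?D A = emeasure uniform_sphere A" .
  qed
  with F_measurable show ?thesis by (simp add: transport_maps_def)
qed

lemma F_colatitude: "z \<in> unit_sphere \<Longrightarrow> colatitude \<theta> (F z) = arccos (m (z \<bullet> \<theta>))"
  by (simp add: colatitude_def F_latitude)

abbreviation "angle_map \<equiv> \<lambda>t. arccos (m (cos t))"

text \<open>
  The lower bound for the cost is a squared difference of colatitudes, so the transport of
  latitudes has to be expressed in this variable; \<open>cos\<close> and \<open>arccos\<close> both reverse the order,
  and monotonicity is preserved.
\<close>
lemma angle_map:
  shows continuous_angle_map: "continuous_on {0..pi} angle_map"
    and strict_mono_angle_map: "strict_mono_on {0..pi} angle_map"
    and image_angle_map: "angle_map ` {0..pi} = {0..pi}"
proof -
  have cb: "cos t \<in> {-1..1}" for t :: real by simp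
  have mb: "m (cos t) \<in> {-1..1}" for t using m_bounds[OF cb] .
  have "continuous_on {0..pi} (\<lambda>t. m (cos t))"
    by (rule continuous_on_compose2[OF continuous_m]) (auto intro!: continuous_intros)
  then show "continuous_on {0..pi} angle_map"
    using mb by (intro continuous_on_arccos) auto
  show "strict_mono_on {0..pi} angle_map"
  proof (rule strict_mono_onI)
    fix s t :: real assume st: "s \<in> {0..pi}" "t \<in> {0..pi}" "s < t"
    then have "cos t < cos s" by (intro cos_monotone_0_pi) auto
    then have "m (cos t) < m (cos s)" by (intro strict_mono_onD[OF strict_mono_m] cb)
    then show "angle_map s < angle_map t" using mb[of s] mb[of t] by (intro arccos_less_arccos) auto
  qed
  show "angle_map ` {0..pi} = {0..pi}"
  proof (intro equalityI subsetI)
    fix b assume "b \<in> angle_map ` {0..pi}"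
    then obtain t where "b = arccos (m (cos t))" by auto
    then show "b \<in> {0..pi}"
      using mb[of t] arccos_lbound[of "m (cos t)"] arccos_ubound[of "m (cos t)"] by simp
  next
    fix b :: real assume b: "b \<in> {0..pi}"
    have "cos b \<in> m ` {-1..1}"
      unfolding bij_betw_imp_surj_on[OF bij_m] by (rule cb)
    then obtain u where u: "cos b = m u" "u \<in> {-1..1}" by (rule imageE)
    have "angle_map (arccos u) = b" "arccos u \<in> {0..pi}"
      using u(2) b arccos_lbound[of u] arccos_ubound[of u] by (auto simp: u(1)[symmetric] arccos_cos)
    then show "b \<in> angle_map ` {0..pi}"
      by (intro image_eqI[where x = "arccos u"]) (simp_all only:)
  qed
qed

text \<open>
  Two inequalities lie between the potentials and the cost: Young's inequality on the line, and the
  Lipschitz bound of the colatitude. Both are tight along the meridian map. If both are tight for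
  another map, the first one prescribes the latitude of the image and the second one the meridian.
\<close>
lemma F_optimal: "optimal_transport_map P F"
  and F_unique: "optimal_transport_map P S \<Longrightarrow> AE z in P. S z = F z"
proof -
  obtain A B where cont: "continuous_on {0..pi} A" "continuous_on {0..pi} B" and
    le: "\<And>x y. x \<in> {0..pi} \<Longrightarrow> y \<in> {0..pi} \<Longrightarrow> A x + B y \<le> (x - y)\<^sup>2 / 2" and
    eq: "\<And>x y. x \<in> {0..pi} \<Longrightarrow> y \<in> {0..pi} \<Longrightarrow> A x + B y = (x - y)\<^sup>2 / 2 \<longleftrightarrow> y = angle_map x"
    by (rule quadratic_cost_potentials[OF continuous_angle_map strict_mono_angle_map image_angle_map]) (rule that)
  let ?Y = "\<lambda>z. A (colatitude \<theta> z)" and ?V = "\<lambda>z. B (colatitude \<theta> z)"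
  have cl: "colatitude \<theta> z \<in> {0..pi}" if "z \<in> unit_sphere" for z
    using colatitude_bounds[OF axis] that by simp
  have ccl: "continuous_on unit_sphere (colatitude \<theta>)"
    unfolding colatitude_def[abs_def]
    using inner_unit_bounds[OF _ axis] by (intro continuous_intros) auto
  have cY: "continuous_on unit_sphere ?Y" and cV: "continuous_on unit_sphere ?V"
    using cl by (intro continuous_on_compose2[OF cont(1) ccl] continuous_on_compose2[OF cont(2) ccl] image_subsetI; simp)+
  have bounded: "\<exists>C. \<forall>z\<in>unit_sphere. \<bar>g z\<bar> \<le> C" if "continuous_on unit_sphere g" for g :: "real^'n \<Rightarrow> real"
    using compact_imp_bounded[OF compact_continuous_image[OF that compact_sphere]]
    by (auto simp: bounded_iff)
  obtain C1 C2 where C: "\<And>z. z \<in> unit_sphere \<Longrightarrow> \<bar>?Y z\<bar> \<le> C1" "\<And>z. z \<in> unit_sphere \<Longrightarrow> \<bar>?V z\<bar> \<le> C2"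
    using bounded[OF cY] bounded[OF cV] by blast
  have axial_le: "?Y y + ?V z \<le> (colatitude \<theta> y - colatitude \<theta> z)\<^sup>2 / 2"
    "(colatitude \<theta> y - colatitude \<theta> z)\<^sup>2 / 2 \<le> transport_cost y z"
    if "y \<in> unit_sphere" "z \<in> unit_sphere" for y z
    using le cl that colatitude_diff_le_geodesic_dist(1)[OF axis, of y z]
      power_mono[of "\<bar>colatitude \<theta> y - colatitude \<theta> z\<bar>" "geodesic_dist y z" 2]
    by (auto simp: transport_cost_def)
  have tight: "?Y y + ?V (F y) = transport_cost y (F y)" if y: "y \<in> unit_sphere" for y
  proof -
    have u: "y \<bullet> \<theta> \<in> {-1..1}" using inner_unit_bounds[OF _ axis] y by simp
    have "colatitude \<theta> (F y) = angle_map (colatitude \<theta> y)"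
      using u F_colatitude[OF y] by (simp add: colatitude_def)
    then have "?Y y + ?V (F y) = (colatitude \<theta> y - colatitude \<theta> (F y))\<^sup>2 / 2"
      using eq cl y F_sphere by blast
    also have "\<dots> = transport_cost y (F y)"
      using geodesic_dist_meridian_map[OF axis _ m_bounds[OF u] m_one m_minus_one] y
      by (simp add: F_colatitude[OF y] transport_cost_def) (simp add: colatitude_def)
    finally show ?thesis .
  qed
  have Ym: "?Y \<in> borel_measurable P" and Vm: "?V \<in> borel_measurable (restrict_space borel unit_sphere)"
    unfolding measurable_cong_sets[OF sets_P refl]
    by (intro borel_measurable_continuous_on_restrict cY cV)+
  have Yb: "\<bar>?Y z\<bar> \<le> C1" if "z \<in> space P" for z using that C(1) by simp
  have feasible: "?Y y + ?V z \<le> transport_cost y z" if "y \<in> space P" "z \<in> unit_sphere" for y z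
    using axial_le[of y z] that by simp
  have tight': "?Y y + ?V (F y) = transport_cost y (F y)" if "y \<in> space P" for y
    using tight that by simp
  note certificate = optimal_transport_map_certificate[OF prob F_transport Ym Yb Vm C(2) feasible tight' space_P sets_P]
  show "optimal_transport_map P F" by (rule certificate(1))
  assume S: "optimal_transport_map P S"
  then have Sm: "S \<in> P \<rightarrow>\<^sub>M restrict_space borel unit_sphere"
    by (simp add: optimal_transport_map_def transport_maps_def)
  have "AE y in P. ?Y y + ?V (S y) = transport_cost y (S y)"
    by (rule certificate(2)) (assumption | rule S)+
  then show "AE y in P. S y = F y"
  proof (rule AE_mp, intro AE_I2 impI)
    fix y assume "y \<in> space P" and slack: "?Y y + ?V (S y) = transport_cost y (S y)"
    then have y: "y \<in> unit_sphere" and Sy: "S y \<in> unit_sphere"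
      using measurable_space[OF Sm] by (auto simp: space_restrict_space)
    let ?a = "y \<bullet> \<theta>" and ?b = "S y \<bullet> \<theta>"
    have ab: "?a \<in> {-1..1}" "?b \<in> {-1..1}" using inner_unit_bounds[OF _ axis] y Sy by auto
    have "?Y y + ?V (S y) = (colatitude \<theta> y - colatitude \<theta> (S y))\<^sup>2 / 2"
      and q: "(colatitude \<theta> y - colatitude \<theta> (S y))\<^sup>2 / 2 = transport_cost y (S y)"
      using axial_le[OF y Sy] slack by linarith+
    then have "arccos ?b = arccos (m ?a)"
      using eq[OF cl[OF y] cl[OF Sy]] ab by (simp add: colatitude_def)
    then have b: "?b = m ?a" using ab m_bounds[OF ab(1)] by (subst (asm) arccos_eq_iff) auto
    have g0: "0 \<le> geodesic_dist y (S y)"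
      using arccos_lbound[of "y \<bullet> S y"] inner_unit_bounds[of y "S y"] y Sy by (simp add: geodesic_dist_def)
    have dist: "\<bar>colatitude \<theta> y - colatitude \<theta> (S y)\<bar> = geodesic_dist y (S y)"
      using q g0 by (simp add: transport_cost_def) (metis abs_of_nonneg power2_eq_iff_nonneg abs_ge_zero power2_abs)
    \<comment> \<open>A pole has no meridian, but its image has the latitude of a pole and so is determined.\<close>
    show "S y = F y"
    proof (cases "perp \<theta> y = 0")
      case False
      then show ?thesis
        using colatitude_diff_le_geodesic_dist(2)[OF axis _ _ dist] y Sy b by (simp add: meridian_map_def)
    next
      case True
      then have "m ?a = 1 \<or> m ?a = -1"
        using pole_latitude[OF axis, of y] y m_one m_minus_one by auto
      then have 0: "sqrt (1 - (m ?a)\<^sup>2) = 0" by auto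
      have "S y = polar_point \<theta> ?b (directional_sign \<theta> (S y))"
        using polar_point_latitude_sign[OF axis, of "S y"] Sy by simp
      then show ?thesis unfolding b meridian_map_def polar_point_def 0 by simp
    qed
  qed
qed

lemma AE_P_continuous_eq:
  fixes G H :: "real^'n \<Rightarrow> 'b::real_normed_vector"
  assumes "continuous_on unit_sphere G" "continuous_on unit_sphere H" and ae: "AE z in P. G z = H z"
    and z: "z \<in> unit_sphere"
  shows "G z = H z"
proof -
  have "AE z in surface_measure. 0 < ennreal (norming_const \<theta> f * f (clip (z \<bullet> \<theta>))) \<longrightarrow> G z = H z"
    using ae unfolding P_eq_density_clip by (simp add: AE_density clip_density_measurable)
  then have "AE z in surface_measure. G z = H z"
    using norming_const_pos f_clip_pos by (simp add: ennreal_zero_less_mult_iff)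
  then show ?thesis using z by (rule AE_surface_measure_continuous_eq[OF assms(1,2)])
qed

lemma directional_df_eq: "directional_df P = restrict F unit_sphere"
  unfolding directional_df_def
proof (rule the_equality)
  let ?R = "restrict F unit_sphere"
  have Rc: "continuous_on unit_sphere ?R" using F_continuous by (rule continuous_on_eq) simp
  have Ro: "optimal_transport_map P ?R"
    using F_optimal by (rule optimal_transport_map_cong[THEN iffD1, rotated]) simp
  have Ru: "AE z in P. S z = ?R z" if "optimal_transport_map P S" for S
    using F_unique[OF that] by (rule AE_mp) (auto intro!: AE_I2)
  show "?R \<in> extensional unit_sphere \<and> continuous_on unit_sphere ?R \<and> optimal_transport_map P ?R \<and>
    (\<forall>S. optimal_transport_map P S \<longrightarrow> (AE z in P. S z = ?R z))"
    using Rc Ro Ru by auto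
  fix G assume G: "G \<in> extensional unit_sphere \<and> continuous_on unit_sphere G \<and>
        optimal_transport_map P G \<and> (\<forall>S. optimal_transport_map P S \<longrightarrow> (AE z in P. S z = G z))"
  show "G = ?R"
  proof (rule extensionalityI[of _ unit_sphere])
    fix z :: "real^'n" assume z: "z \<in> unit_sphere"
    show "G z = ?R z" using G Rc Ru z by (intro AE_P_continuous_eq) auto
  qed (use G in auto)
qed

end

theorem proposition4:
  fixes \<theta> :: "real^'n" and f :: "real \<Rightarrow> real" and z :: "real^'n"
  assumes "2 \<le> CARD('n)"
    and "\<theta> \<in> unit_sphere"
    and "angular_function f"
    and "unique_rotation_axis \<theta> f"
    and "rotsym_distribution \<theta> f \<in> bounded_density_family"
    and "z \<in> unit_sphere"
  shows "directional_df (rotsym_distribution \<theta> f) z =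
           angular_transport CARD('n) f (z \<bullet> \<theta>) *\<^sub>R \<theta> +
           sqrt (1 - (angular_transport CARD('n) f (z \<bullet> \<theta>))\<^sup>2) *\<^sub>R directional_sign \<theta> z"
proof -
  interpret rotationally_symmetric \<theta> "CARD('n)" f
  proof (rule rotationally_symmetric.intro)
    show "norm \<theta> = 1" using assms(2) by simp
    show "prob_space (rotsym_distribution \<theta> f)" using assms(5) by (simp add: bounded_density_family_def)
  qed (rule refl assms(1) assms(3))+
  have "angular_transport CARD('n) f = m"
    unfolding angular_transport_def[abs_def] uniform_angular_quantile_def monotone_transport_def[abs_def]
      angular_cdf_def uniform_angular_cdf_def[abs_def] normalized_cdf_def[abs_def] axial_weight_def ..
  then show ?thesis
    using assms(6) by (simp add: directional_df_eq meridian_map_def polar_point_def)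
qed

end
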